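(* Let \[I(z,0)=\sum_{n\geq 0}|\mathcal P^{-1}(\mathrm{Av}_n(231))\cap\overline{\mathsf D}\mathsf{Mot}|\,z^n=\sum_{n\geq 1}|\mathcal W_2(n)\cap\mathrm{EDP}|\,z^n\] be the generating function that counts (standardized, nonempty) $2$-stack-sortable permutations whose descents are all peaks. Then $\mathcal R(I(z,0),z)=0$, where \[\mathcal R(v,z)=(-z + 3 z^2 + 24 z^3 + z^4) + (1 - 4 z - 27 z^2 + 26 z^3 + 4 z^4) v + (4 z - 4 z^2 + 29 z^3 + 7 z^4) v^2\] \[+ (6 z^2 + 4 z^3 + 7 z^4) v^3 + 4 (z^3 + z^4) v^4 + z^4 v^5.\]
   Context: $S_n$ is the set of permutations of $\{1,\dots,n\}$ in one-line notation. $\mathrm{Av}_n(231)$ is the set of $\pi\in S_n$ with no indices $i_1<i_2<i_3$ such that $\pi_{i_3}<\pi_{i_1}<\pi_{i_2}$. West's stack-sorting map $s$ is defined recursively: $s$ of the empty permutation is empty, and if $\pi=LmR$ with $m$ the largest entry of $\pi$, then $s(\pi)=s(L)\,s(R)\,m$. $\mathcal W_2(n)$ is the set of $2$-stack-sortable permutations in $S_n$, i.e. those $\pi\in S_n$ with $s(s(\pi))$ increasing. A descent of $\pi=\pi_1\cdots\pi_n$ is an index $i\in\{1,\dots,n-1\}$ with $\pi_i>\pi_{i+1}$; a peak is an index $i\in\{2,\ldots,n-1\}$ with $\pi_{i-1}<\pi_i>\pi_{i+1}$. $\mathrm{EDP}$ is the set of permutations in which every descent is a peak. A binary plane tree is a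 finite rooted tree in which every vertex has at most two children, every child is designated as either a left child or a right child (not both), and no vertex has two left or two right children; a Motzkin tree is a nonempty binary plane tree in which every child that has no siblings is a left child. $\overline{\mathsf D}\mathsf{Mot}$ is the set of Motzkin trees with vertices bijectively labeled by $1,\dots,m$ ($m$ the number of vertices) so that every nonroot vertex has a smaller label than its parent. The postorder reading is $\mathcal P(\mathcal T)=\mathcal P(\mathcal T_L)\,\mathcal P(\mathcal T_R)\,m$, where $m$ is the root label and $\mathcal T_L,\mathcal T_R$ are the left and right subtrees of the root (the empty tree has empty reading); $\mathcal P^{-1}(A)$ is the set of trees whose postorder reading lies in $A$. *)

theory Defs
  imports
    "HOL-Library.Tree"
    "HOL-Combinatorics.Multiset_Permutations"
    "HOL-Computational_Algebra.Formal_Power_Series"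
begin

(* Permutations are lists in one-line notation. List positions start at 0, so the entry pi_i of
   the usual notation is "p ! (i - 1)", and indices of descents and peaks below are shifted
   by one accordingly. *)

definition perms :: "nat \<Rightarrow> nat list set" where
  "perms n = permutations_of_set {1..n}"

definition Av231 :: "nat \<Rightarrow> nat list set" where
  "Av231 n = {p \<in> perms n.
     \<not> (\<exists>i j k. i < j \<and> j < k \<and> k < length p \<and> p ! k < p ! i \<and> p ! i < p ! j)}"

(* "takeWhile" and "tl (dropWhile ...)" are the parts L and R of p = L m R; in a permutation the
   maximum m occurs exactly once. *)
function stack_sort :: "nat list \<Rightarrow> nat list" where
  "stack_sort p =
     (if p = [] then []
      else let m = Max (set p) in
        stack_sort (takeWhile (\<lambda>x. x \<noteq> m) p) @
        stack_sort (tl (dropWhile (\<lambda>x. x \<noteq> m) p)) @ [m])"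
  by pat_completeness auto
termination
proof (relation "measure length", goal_cases)
  case 1
  then show ?case by simp
next
  case (2 p m)
  then have "m \<in> set p" by simp
  then have "takeWhile (\<lambda>x. x \<noteq> m) p \<noteq> p"
    by (auto simp: takeWhile_eq_all_conv)
  then show ?case
    by (metis in_measure le_neq_implies_less length_takeWhile_le takeWhile_eq_take take_all_iff
        order_refl)
next
  case (3 p m)
  then show ?case
    using length_dropWhile_le[of "\<lambda>x. x \<noteq> m" p] by (cases p) auto
qed

declare stack_sort.simps [simp del]

definition W2 :: "nat \<Rightarrow> nat list set" where
  "W2 n = {p \<in> perms n. sorted_wrt (<) (stack_sort (stack_sort p))}"

definition is_descent :: "nat list \<Rightarrow> nat \<Rightarrow> bool" where
  "is_descent p i \<longleftrightarrow> i + 1 < length p \<and> p ! i > p ! (i + 1)"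

definition is_peak :: "nat list \<Rightarrow> nat \<Rightarrow> bool" where
  "is_peak p i \<longleftrightarrow> 0 < i \<and> i + 1 < length p \<and> p ! (i - 1) < p ! i \<and> p ! i > p ! (i + 1)"

definition EDP :: "nat list set" where
  "EDP = {p. (\<exists>n. p \<in> perms n) \<and> (\<forall>i. is_descent p i \<longrightarrow> is_peak p i)}"

(* A labeled binary plane tree is a value of the library type "nat tree": a constructor "Node l a r"
   is a vertex with label a, and a subtree that is "Leaf" (the empty tree) is an absent child.
   The postorder reading is the library function "postorder". *)

fun only_children_left :: "'a tree \<Rightarrow> bool" where
  "only_children_left Leaf \<longleftrightarrow> True"
| "only_children_left (Node l a r) \<longleftrightarrow>
     (r \<noteq> Leaf \<longrightarrow> l \<noteq> Leaf) \<and> only_children_left l \<and> only_children_left r"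

definition motzkin :: "'a tree \<Rightarrow> bool" where
  "motzkin t \<longleftrightarrow> t \<noteq> Leaf \<and> only_children_left t"

fun decreasing_labels :: "nat tree \<Rightarrow> bool" where
  "decreasing_labels Leaf \<longleftrightarrow> True"
| "decreasing_labels (Node l a r) \<longleftrightarrow>
     (\<forall>l1 b r1. l = Node l1 b r1 \<or> r = Node l1 b r1 \<longrightarrow> b < a) \<and>
     decreasing_labels l \<and> decreasing_labels r"

(* The vertices of t are listed, with their labels, by "inorder t". *)
definition standard_labels :: "nat tree \<Rightarrow> bool" where
  "standard_labels t \<longleftrightarrow> distinct (inorder t) \<and> set_tree t = {1..size t}"

definition DMot :: "nat tree set" where
  "DMot = {t. motzkin t \<and> standard_labels t \<and> decreasing_labels t}"

(* The series I(z,0). *)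
definition I0 :: "int fps" where
  "I0 = Abs_fps (\<lambda>n. int (card (postorder -` Av231 n \<inter> DMot)))"

definition R_poly :: "'a::comm_ring_1 \<Rightarrow> 'a \<Rightarrow> 'a" where
  "R_poly v z =
     (- z + 3 * z^2 + 24 * z^3 + z^4)
     + (1 - 4 * z - 27 * z^2 + 26 * z^3 + 4 * z^4) * v
     + (4 * z - 4 * z^2 + 29 * z^3 + 7 * z^4) * v^2
     + (6 * z^2 + 4 * z^3 + 7 * z^4) * v^3
     + 4 * (z^3 + z^4) * v^4
     + z^4 * v^5"

end

theory Submission
  imports Defs "HOL-Library.Sublist"
begin

text \<open>
  Reading a decreasing binary tree in symmetric order identifies these trees with permutations.
  Under this identification \<^const>\<open>stack_sort\<close> turns the inorder reading into the postorder
  reading (\<open>stack_sort_inorder\<close>), and "every descent is a peak" says exactly that an only child is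
  a left child (\<open>descents_are_peaks_inorder\<close>). Since one pass of stack-sorting sorts precisely the
  231-avoiding permutations (\<open>sorted_stack_sort_iff\<close>), this proves that the two counting
  sequences agree.

  For the algebraic equation, call \<open>k\<close> a cut of a word if every one of its first \<open>k\<close> letters is
  smaller than every later letter. Let \<open>T\<close> be a tree with nonempty left subtree \<open>L\<close> and with right
  subtree \<open>R\<close>. Its postorder reading avoids 231 if and only if those of \<open>L\<close> and \<open>R\<close> do and the
  labels interleave in the following way: all labels of \<open>L\<close> except its root lie below all labels of
  \<open>R\<close>, and the root label of \<open>L\<close> splits the labels of \<open>R\<close> at a cut \<open>k\<close> of the reading of \<open>R\<close>.
  So \<open>T\<close> amounts to a triple \<open>(L, k, R)\<close>, and its number of cuts is the number of cuts of \<open>L\<close>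
  plus the number of cuts of \<open>R\<close> that are at least \<open>k\<close> (\<open>glue_av_trees\<close>, \<open>glue_inject\<close>,
  \<open>glue_surj\<close>). As \<open>k\<close> varies, the latter number takes each value from 1 to the number of cuts
  of \<open>R\<close> once. With \<open>x\<close> marking cuts, \<open>z\<close> marking vertices and \<open>v\<close> the series to be determined,
  the generating function \<open>G\<close> of nonempty trees therefore satisfies
  \<open>(x - 1) G = z (x\<^sup>2 (x - 1) + x G (x - 1 + G - v))\<close>.

  This equation is quadratic in \<open>G\<close>, with one catalytic variable \<open>x\<close>, and Brown's quadratic method
  applies (\<open>quadratic_method\<close>). Completing the square, the discriminant \<open>\<Delta>(x)\<close> equals \<open>S(x)\<^sup>2\<close> with
  \<open>S(x) = 2 z x G(x) + b(x)\<close>. There is a power series \<open>x\<close> in \<open>z\<close> with \<open>S(x) = 0\<close>, which is thus a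
  double root of \<open>\<Delta>\<close>. Writing \<open>G = x y\<close>, the equations \<open>S = 0\<close>, \<open>\<Delta> = 0\<close>, \<open>\<Delta>' = 0\<close> become
  the rational parametrization
  \<open>x = 1 / (1 - y\<^sup>2)\<close>, \<open>z = y (1 - y\<^sup>2)\<^sup>2 / (1 + y + y\<^sup>2)\<close>, \<open>v = y (1 - 3 y\<^sup>2 - y\<^sup>3) / (1 - y\<^sup>2)\<^sup>2\<close>,
  on which \<^const>\<open>R_poly\<close> vanishes identically.

  Derivatives are avoided: \<open>x - x'\<close> divides \<open>G(x) - G(x')\<close>, and this alone yields both the
  existence of the root, as the fixed point of a contraction, and the vanishing of \<open>\<Delta>'\<close>, because
  \<open>\<Delta>(x + h) = S(x + h)\<^sup>2\<close> is divisible by \<open>h\<^sup>2\<close> for every nonzero \<open>h\<close>.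
\<close>

section \<open>Words avoiding 231\<close>

text \<open>
  Occurrences as subsequences, rather than as triples of positions, split along a concatenation
  without any arithmetic on indices.
\<close>

definition avoids231 :: "'a :: linorder list \<Rightarrow> bool" where
  "avoids231 w \<longleftrightarrow> (\<forall>x y z. subseq [x, y, z] w \<longrightarrow> \<not> (z < x \<and> x < y))"

lemma subseq_append_iff_take_drop:
  "subseq xs (u @ v) \<longleftrightarrow> (\<exists>i\<le>length xs. subseq (take i xs) u \<and> subseq (drop i xs) v)"
proof
  assume "subseq xs (u @ v)"
  then obtain a b where "xs = a @ b" "subseq a u" "subseq b v"
    by (auto simp: subseq_append_iff)
  then show "\<exists>i\<le>length xs. subseq (take i xs) u \<and> subseq (drop i xs) v"
    by (intro exI[of _ "length a"]) simp
qed (metis append_take_drop_id subseq_append_iff)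

lemma subseq2_append:
  "subseq [y, z] (u @ v) \<longleftrightarrow>
     subseq [y, z] u \<or> (y \<in> set u \<and> z \<in> set v) \<or> subseq [y, z] v"
  unfolding subseq_append_iff_take_drop
  by (auto simp: le_Suc_eq ex_disj_distrib conj_disj_distribR subseq_singleton_left)

lemma subseq3_append:
  "subseq [x, y, z] (u @ v) \<longleftrightarrow>
     subseq [x, y, z] u \<or> (subseq [x, y] u \<and> z \<in> set v) \<or>
     (x \<in> set u \<and> subseq [y, z] v) \<or> subseq [x, y, z] v"
  unfolding subseq_append_iff_take_drop
  by (auto simp: le_Suc_eq ex_disj_distrib conj_disj_distribR subseq_singleton_left)

lemma set_subset_of_subseq: "subseq xs ys \<Longrightarrow> set xs \<subseteq> set ys"
  by (auto simp: subseq_conv_nths dest: in_set_nthsD)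

lemma subseq3_iff_nth:
  "subseq [x, y, z] w \<longleftrightarrow>
     (\<exists>i j k. i < j \<and> j < k \<and> k < length w \<and> w ! i = x \<and> w ! j = y \<and> w ! k = z)"
proof
  assume "subseq [x, y, z] w"
  then obtain a w' where "w = a @ x # w'" "subseq [y, z] w'"
    by (blast dest: list_emb_ConsD)
  moreover from this obtain b w'' where "w' = b @ y # w''" "subseq [z] w''"
    by (blast dest: list_emb_ConsD)
  moreover from this obtain c d where "w'' = c @ z # d"
    by (blast dest: list_emb_ConsD)
  ultimately show "\<exists>i j k. i < j \<and> j < k \<and> k < length w \<and> w ! i = x \<and> w ! j = y \<and> w ! k = z"
    by (intro exI[of _ "length a"] exI[of _ "Suc (length a + length b)"]
        exI[of _ "Suc (Suc (length a + length b + length c))"]) (auto simp: nth_append)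
next
  assume "\<exists>i j k. i < j \<and> j < k \<and> k < length w \<and> w ! i = x \<and> w ! j = y \<and> w ! k = z"
  then obtain i j k where ijk: "i < j" "j < k" "k < length w" "w ! i = x" "w ! j = y" "w ! k = z"
    by blast
  have "w = take j w @ y # drop (Suc j) w"
    using ijk by (metis id_take_nth_drop order_less_trans)
  moreover have "x \<in> set (take j w)"
    using ijk by (auto simp: in_set_conv_nth)
  moreover have "z \<in> set (drop (Suc j) w)"
    using ijk by (auto simp: in_set_conv_nth intro!: exI[of _ "k - Suc j"])
  ultimately show "subseq [x, y, z] w"
    by (metis subseq3_append subseq_Cons2 subseq_singleton_left)
qed

lemma mem_perms_iff: "p \<in> perms n \<longleftrightarrow> set p = {1..n} \<and> distinct p"
  by (auto simp: perms_def permutations_of_set_def)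

lemma avoids231_iff_nth:
  "avoids231 w \<longleftrightarrow>
     \<not> (\<exists>i j k. i < j \<and> j < k \<and> k < length w \<and> w ! k < w ! i \<and> w ! i < w ! j)"
  unfolding avoids231_def subseq3_iff_nth by blast

lemma Av231_eq: "Av231 n = {p \<in> perms n. avoids231 p}"
  unfolding Av231_def avoids231_iff_nth ..

lemma avoids231_append:
  "avoids231 (u @ v) \<longleftrightarrow> avoids231 u \<and> avoids231 v \<and>
     (\<forall>x y z. subseq [x, y] u \<longrightarrow> z \<in> set v \<longrightarrow> \<not> (z < x \<and> x < y)) \<and>
     (\<forall>x y z. x \<in> set u \<longrightarrow> subseq [y, z] v \<longrightarrow> \<not> (z < x \<and> x < y))"
  unfolding avoids231_def subseq3_append by blast

lemma avoids231_Nil [simp]: "avoids231 []"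
  by (simp add: avoids231_def)

lemma avoids231_singleton [simp]: "avoids231 [m]"
  by (auto simp: avoids231_def)

lemma avoids231_snoc_max:
  assumes "\<forall>x\<in>set w. x < m"
  shows "avoids231 (w @ [m]) \<longleftrightarrow> avoids231 w"
proof -
  have "\<not> m < x" if "subseq [x, y] w" for x y
    using set_subset_of_subseq[OF that] assms by fastforce
  then show ?thesis
    unfolding avoids231_append by auto
qed

text \<open>
  An occurrence that uses \<open>m\<close> has it as its largest letter, so it takes the other two letters
  from the two sides of \<open>m\<close>; occurrences that cross \<open>m\<close> without using it yield one that uses it.
\<close>

lemma avoids231_insert_max:
  assumes max: "\<forall>x\<in>set u \<union> set v. x < m" and disj: "set u \<inter> set v = {}"
  shows "avoids231 (u @ m # v) \<longleftrightarrow>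
    avoids231 u \<and> avoids231 v \<and> (\<forall>x\<in>set u. \<forall>y\<in>set v. x < y)" (is "?A \<longleftrightarrow> ?B")
proof
  assume ?A
  have "\<not> y < x" if "x \<in> set u" "y \<in> set v" for x y
  proof -
    have "subseq [m, y] ([m] @ v)" using that unfolding subseq2_append by simp
    then have "subseq [x, m, y] (u @ m # v)"
      using that unfolding subseq3_append by simp
    then show ?thesis using \<open>?A\<close> max that by (auto simp: avoids231_def)
  qed
  moreover have "avoids231 u" "avoids231 v"
    using \<open>?A\<close> avoids231_append[of u "m # v"] avoids231_append[of "[m]" v] by auto
  ultimately show ?B using disj by (auto simp: not_less le_less)
next
  assume B: ?B
  have "\<not> m < y" if "subseq [y, z] v" for y z
    using set_subset_of_subseq[OF that] max by (auto simp: not_less less_imp_le)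
  then have mv: "avoids231 (m # v)"
    using B avoids231_append[of "[m]" v] by auto
  have less: "x < z" if "x \<in> set u" "z \<in> set (m # v)" for x z
    using that B max by auto
  have "\<not> z < x" if "subseq [x, y] u" "z \<in> set (m # v)" for x y z
    using less[of x z] set_subset_of_subseq[OF that(1)] that(2) by auto
  moreover have "\<not> z < x" if "x \<in> set u" "subseq [y, z] (m # v)" for x y z
    using less[of x z] set_subset_of_subseq[OF that(2)] that(1) by auto
  ultimately show ?A
    unfolding avoids231_append using B mv by blast
qed

lemma avoids231_map:
  assumes "strict_mono f"
  shows "avoids231 (map f w) \<longleftrightarrow> avoids231 w"
proof -
  have "(i < j \<and> j < k \<and> k < length (map f w) \<and> map f w ! k < map f w ! i \<and> map f w ! i < map f w ! j)
      \<longleftrightarrow> (i < j \<and> j < k \<and> k < length w \<and> w ! k < w ! i \<and> w ! i < w ! j)" for i j k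
  proof (cases "i < j \<and> j < k \<and> k < length w")
    case True
    then show ?thesis using strict_mono_less[OF assms] by simp
  qed auto
  then show ?thesis unfolding avoids231_iff_nth by simp
qed

section \<open>Decreasing trees and stack-sorting\<close>

text \<open>
  The definition of \<^const>\<open>decreasing_labels\<close> compares a vertex with its children only; all
  arguments below need the comparison with all descendants.
\<close>

lemma decreasing_labels_Node:
  "decreasing_labels (Node l a r) \<longleftrightarrow>
     (\<forall>x\<in>set_tree l \<union> set_tree r. x < a) \<and> decreasing_labels l \<and> decreasing_labels r"
proof -
  have root: "x \<le> b" if "decreasing_labels t" "t = Node l b r" "x \<in> set_tree t" for t l b r x
    using that
  proof (induction t arbitrary: l b r)
    case (Node l1 c r1)
    have "x < b" if "s = l1 \<or> s = r1" "x \<in> set_tree s" for s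
    proof (cases s)
      case s: (Node l2 d r2)
      have "decreasing_labels s" "d < b"
        using Node.prems that s by auto
      moreover have "x \<le> d"
        using that(1)
      proof
        assume "s = l1"
        then show ?thesis using Node.IH(1)[of l2 d r2] s that(2) \<open>decreasing_labels s\<close> by blast
      next
        assume "s = r1"
        then show ?thesis using Node.IH(2)[of l2 d r2] s that(2) \<open>decreasing_labels s\<close> by blast
      qed
      ultimately show ?thesis by simp
    qed (use that in simp)
    then show ?case using Node.prems by (auto intro: less_imp_le)
  qed simp
  have child: "(\<forall>x\<in>set_tree t. x < a) \<longleftrightarrow> (\<forall>l1 b r1. t = Node l1 b r1 \<longrightarrow> b < a)"
    if "decreasing_labels t" for t
  proof (cases t)
    case (Node l1 b r1)
    then show ?thesis using root[OF that Node] by (auto intro: order_le_less_trans)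
  qed simp
  show ?thesis
    using child[of l] child[of r] by auto
qed

declare decreasing_labels.simps(2) [simp del]

lemma distinct_postorder: "distinct (postorder t) \<longleftrightarrow> distinct (inorder t)"
  by (induction t) auto

text \<open>
  In a decreasing tree the root is the largest letter of the inorder reading, so \<open>stack_sort\<close>
  recurses exactly on the two subtrees.
\<close>

lemma stack_sort_inorder:
  "decreasing_labels t \<Longrightarrow> stack_sort (inorder t) = postorder t"
proof (induction t)
  case (Node l a r)
  have less: "\<forall>x\<in>set_tree l \<union> set_tree r. x < a"
    using Node.prems by (simp add: decreasing_labels_Node)
  have "Max (set (inorder (Node l a r))) = a"
    by (rule Max_eqI) (use less in \<open>auto intro: less_imp_le\<close>)
  moreover have "takeWhile (\<lambda>x. x \<noteq> a) (inorder l @ a # inorder r) = inorder l"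
    using less by (subst takeWhile_append2) auto
  moreover have "dropWhile (\<lambda>x. x \<noteq> a) (inorder l @ a # inorder r) = a # inorder r"
    using less by (subst dropWhile_append2) auto
  ultimately show ?case
    using Node by (subst stack_sort.simps) (simp add: decreasing_labels_Node Let_def)
qed (simp add: stack_sort.simps)

lemma inorder_inject_decreasing:
  "decreasing_labels s \<Longrightarrow> decreasing_labels t \<Longrightarrow> inorder s = inorder t \<Longrightarrow> s = t"
proof (induction s arbitrary: t)
  case Leaf
  then show ?case by (metis eq_inorder_Nil inorder.simps(1))
next
  case (Node l a r)
  then obtain l' a' r' where t: "t = Node l' a' r'"
    by (cases t) auto
  have less: "\<forall>x\<in>set_tree l \<union> set_tree r. x < a" "\<forall>x\<in>set_tree l' \<union> set_tree r'. x < a'"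
    using Node.prems by (simp_all add: t decreasing_labels_Node)
  have "set (inorder (Node l a r)) = set (inorder t)"
    using Node.prems by metis
  then have "insert a (set_tree l \<union> set_tree r) = insert a' (set_tree l' \<union> set_tree r')"
    by (simp add: t)
  with less have "a' = a"
    by (metis insert_iff order_less_asym)
  with Node.prems(3) less have "inorder l = inorder l' \<and> inorder r = inorder r'"
    using append_Cons_eq_iff[of a "inorder l" "inorder r" "inorder l'" "inorder r'"]
    by (auto simp: t)
  with Node.IH Node.prems show ?case
    by (simp add: t \<open>a' = a\<close> decreasing_labels_Node)
qed

lemma ex_decreasing_tree:
  "distinct p \<Longrightarrow> \<exists>t. decreasing_labels t \<and> inorder t = p"
proof (induction "length p" arbitrary: p rule: less_induct)
  case less
  show ?case
  proof (cases "p = []")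
    case False
    define m where "m = Max (set p)"
    have m: "x \<le> m" if "x \<in> set p" for x
      using that by (simp add: m_def)
    have "m \<in> set p"
      using False by (simp add: m_def)
    then obtain u v where p: "p = u @ m # v"
      by (metis split_list)
    then have *: "distinct u" "distinct v" "m \<notin> set u \<union> set v"
      using less.prems by auto
    have "length u < length p" "length v < length p"
      by (simp_all add: p)
    then obtain l r where "decreasing_labels l" "inorder l = u" "decreasing_labels r" "inorder r = v"
      using less.hyps *(1,2) by meson
    moreover have "\<forall>x\<in>set u \<union> set v. x < m"
      using m *(3) by (auto simp: p order_le_less)
    ultimately show ?thesis
      by (intro exI[of _ "Node l m r"]) (simp add: p decreasing_labels_Node flip: set_inorder)
  qed (auto intro!: exI[of _ Leaf])
qed

text \<open>
  Knuth's characterization of stack-sortable permutations. In terms of trees, both sides ask at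
  every vertex that the labels on the left be smaller than those on the right.
\<close>

lemma sorted_stack_sort_iff:
  assumes "distinct p"
  shows "sorted_wrt (<) (stack_sort p) \<longleftrightarrow> avoids231 p"
proof -
  have "sorted_wrt (<) (postorder t) \<longleftrightarrow> avoids231 (inorder t)"
    if "decreasing_labels t" "distinct (inorder t)" for t :: "nat tree"
    using that
  proof (induction t)
    case (Node l a r)
    have less: "\<forall>x\<in>set_tree l \<union> set_tree r. x < a"
      using Node.prems by (simp add: decreasing_labels_Node)
    have "avoids231 (inorder (Node l a r)) \<longleftrightarrow> avoids231 (inorder l) \<and> avoids231 (inorder r) \<and>
        (\<forall>x\<in>set_tree l. \<forall>y\<in>set_tree r. x < y)"
      using avoids231_insert_max[of "inorder l" "inorder r" a] less Node.prems by simp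
    then show ?case
      using Node less by (auto simp: sorted_wrt_append decreasing_labels_Node)
  qed simp
  with assms show ?thesis
    by (metis ex_decreasing_tree stack_sort_inorder)
qed

text \<open>
  A letter of the inorder reading is followed by a smaller one if its vertex has a right child, and
  preceded by a smaller one if its vertex has a left child. The induction separates the positions
  left of, at, and right of the root letter; the first position of the right part follows the larger
  root letter, so it is no peak, just as it is no peak of the right part on its own.
\<close>

lemma descents_are_peaks_inorder:
  "decreasing_labels t \<Longrightarrow>
    (\<forall>i. is_descent (inorder t) i \<longrightarrow> is_peak (inorder t) i) \<longleftrightarrow> only_children_left t"
proof (induction t)
  case Leaf
  then show ?case by (simp add: is_descent_def)
next
  case (Node l a r)
  define u v where "u = inorder l" and "v = inorder r"
  have less: "x < a" if "x \<in> set u \<union> set v" for x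
    using Node.prems that by (auto simp: decreasing_labels_Node u_def v_def)
  define bad where "bad p i \<longleftrightarrow> is_descent p i \<and> \<not> is_peak p i" for p i
  let ?p = "u @ a # v"
  have bad_l: "bad ?p i \<longleftrightarrow> bad u i" if "i < length u" for i
  proof (cases "i + 1 < length u")
    case True
    then show ?thesis by (auto simp: bad_def is_descent_def is_peak_def nth_append)
  next
    case False
    with that have "i + 1 = length u" "u ! i < a" by (simp_all add: less)
    then show ?thesis using that by (auto simp: bad_def is_descent_def nth_append)
  qed
  have bad_m: "bad ?p (length u) \<longleftrightarrow> u = [] \<and> v \<noteq> []"
  proof (cases "u = []")
    case True
    then show ?thesis
      using less by (cases v) (auto simp: bad_def is_descent_def is_peak_def)
  next
    case False
    then have "u ! (length u - 1) < a" by (simp add: less)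
    with False show ?thesis
      by (auto simp: bad_def is_descent_def is_peak_def nth_append)
  qed
  have bad_r: "bad ?p (Suc (length u + i)) \<longleftrightarrow> bad v i" for i
  proof (cases i)
    case 0
    show ?thesis
    proof (cases v)
      case (Cons c w)
      then have "c < a" by (simp add: less)
      with 0 Cons show ?thesis
        by (auto simp: bad_def is_descent_def is_peak_def nth_append)
    qed (simp add: 0 bad_def is_descent_def)
  next
    case (Suc j)
    then show ?thesis by (auto simp: bad_def is_descent_def is_peak_def nth_append)
  qed
  have "(\<exists>i. bad ?p i) \<longleftrightarrow> (\<exists>i. bad u i) \<or> (u = [] \<and> v \<noteq> []) \<or> (\<exists>i. bad v i)" (is "?L \<longleftrightarrow> ?R")
  proof
    assume ?L
    then obtain i where i: "bad ?p i" ..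
    consider "i < length u" | "i = length u" | j where "i = Suc (length u + j)"
      by (metis less_imp_Suc_add linorder_neqE_nat)
    then show ?R using i bad_l bad_m bad_r by cases auto
  next
    assume ?R
    moreover have "i < length u" if "bad u i" for i
      using that by (simp add: bad_def is_descent_def)
    ultimately show ?L using bad_l bad_m bad_r by metis
  qed
  moreover have "(\<forall>i. \<not> bad u i) \<longleftrightarrow> only_children_left l" "(\<forall>i. \<not> bad v i) \<longleftrightarrow> only_children_left r"
    using Node by (simp_all add: bad_def u_def v_def decreasing_labels_Node)
  ultimately have "(\<forall>i. \<not> bad ?p i) \<longleftrightarrow> only_children_left (Node l a r)"
    by (auto simp: u_def v_def)
  then show ?case by (simp add: bad_def u_def v_def)
qed

section \<open>The trees counted by the series\<close>

text \<open>
  The empty tree is included for \<open>n = 0\<close>, so that both subtrees of a root come from the same family.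
\<close>

definition av_trees :: "nat \<Rightarrow> nat tree set" where
  "av_trees n = {t. only_children_left t \<and> decreasing_labels t \<and> distinct (inorder t) \<and>
     set_tree t = {1..n} \<and> avoids231 (postorder t)}"

lemma size_av_trees: "t \<in> av_trees n \<Longrightarrow> size t = n"
  using distinct_card[of "inorder t"] by (simp add: av_trees_def)

lemma av_trees_0 [simp]: "av_trees 0 = {Leaf}"
  by (auto simp: av_trees_def)

lemma Leaf_in_av_trees_iff: "Leaf \<in> av_trees n \<longleftrightarrow> n = 0"
  by (auto simp: av_trees_def)

lemma DMot_Av231_eq: "postorder -` Av231 n \<inter> DMot = (if n = 0 then {} else av_trees n)"
proof -
  have "t \<in> postorder -` Av231 n \<inter> DMot \<longleftrightarrow> t \<noteq> Leaf \<and> t \<in> av_trees n" for t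
  proof (cases "set_tree t = {1..n} \<and> distinct (inorder t)")
    case True
    then have "card (set (inorder t)) = size t"
      using distinct_card length_inorder by metis
    with True have "size t = n" by simp
    moreover have "set (postorder t) = {1..n}" "distinct (postorder t)"
      using True by (simp_all add: distinct_postorder)
    ultimately show ?thesis
      using True unfolding DMot_def motzkin_def standard_labels_def Av231_eq av_trees_def
        vimage_def mem_Collect_eq Int_iff mem_perms_iff
      by blast
  next
    case False
    then show ?thesis
      unfolding Av231_eq av_trees_def vimage_def mem_Collect_eq Int_iff mem_perms_iff
        set_postorder distinct_postorder
      by blast
  qed
  then have "postorder -` Av231 n \<inter> DMot = av_trees n - {Leaf}" by blast
  then show ?thesis
    by (cases "n = 0") (simp_all add: Leaf_in_av_trees_iff)
qed

lemma bij_betw_inorder: "bij_betw inorder (av_trees n) (W2 n \<inter> EDP)"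
  unfolding bij_betw_def
proof
  show "inj_on inorder (av_trees n)"
    by (auto simp: inj_on_def av_trees_def intro: inorder_inject_decreasing)
  have iff: "inorder t \<in> W2 n \<inter> EDP \<longleftrightarrow> t \<in> av_trees n" if "decreasing_labels t" for t
  proof (cases "distinct (inorder t)")
    case True
    have "sorted_wrt (<) (stack_sort (stack_sort (inorder t))) \<longleftrightarrow> avoids231 (postorder t)"
      using True that by (simp add: stack_sort_inorder sorted_stack_sort_iff distinct_postorder)
    with True that show ?thesis
      unfolding W2_def EDP_def av_trees_def mem_Collect_eq Int_iff mem_perms_iff set_inorder
        descents_are_peaks_inorder[OF that]
      by blast
  next
    case False
    then show ?thesis
      unfolding W2_def av_trees_def mem_Collect_eq Int_iff mem_perms_iff by blast
  qed
  show "inorder ` av_trees n = W2 n \<inter> EDP"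
  proof (intro equalityI subsetI)
    fix p assume "p \<in> inorder ` av_trees n"
    then show "p \<in> W2 n \<inter> EDP" using iff by (auto simp: av_trees_def)
  next
    fix p assume p: "p \<in> W2 n \<inter> EDP"
    then have "distinct p" by (simp add: W2_def mem_perms_iff)
    then obtain t where "decreasing_labels t" "inorder t = p"
      using ex_decreasing_tree by blast
    with p iff show "p \<in> inorder ` av_trees n" by blast
  qed
qed

lemma finite_av_trees: "finite (av_trees n)"
proof -
  have "finite (W2 n)" by (simp add: W2_def perms_def)
  then show ?thesis using bij_betw_finite[OF bij_betw_inorder] by blast
qed

lemma I0_eq_card: "I0 = Abs_fps (\<lambda>n. if n = 0 then 0 else int (card (av_trees n)))"
  unfolding I0_def by (rule fps_ext) (simp add: DMot_Av231_eq)

section \<open>Cuts of words\<close>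

text \<open>
  For a permutation, the cuts are the boundaries of its decomposition into sum-indecomposable
  blocks, including the two ends of the word.
\<close>

definition cuts :: "'a :: linorder list \<Rightarrow> nat set" where
  "cuts w = {k. k \<le> length w \<and> (\<forall>x\<in>set (take k w). \<forall>y\<in>set (drop k w). x < y)}"

lemma finite_cuts [simp]: "finite (cuts w)"
  by (rule finite_subset[of _ "{..length w}"]) (auto simp: cuts_def)

lemma cuts_Nil [simp]: "cuts [] = {0}"
  by (auto simp: cuts_def)

lemma cuts_map: "strict_mono f \<Longrightarrow> cuts (map f w) = cuts w"
  by (simp add: cuts_def take_map drop_map strict_mono_less)

lemma cuts_snoc_max:
  assumes "\<forall>x\<in>set w. x < m"
  shows "cuts (w @ [m]) = insert (Suc (length w)) (cuts w)"
proof -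
  have "k \<in> cuts (w @ [m]) \<longleftrightarrow> k = Suc (length w) \<or> k \<in> cuts w" for k
  proof (cases "k \<le> length w")
    case True
    then have "\<forall>x\<in>set (take k w). x < m"
      using assms by (meson in_set_takeD)
    with True show ?thesis by (auto simp: cuts_def)
  next
    case False
    then show ?thesis by (auto simp: cuts_def)
  qed
  then show ?thesis by blast
qed

text \<open>
  Here \<open>u @ [a]\<close> is the reading of the left subtree and \<open>w\<close> that of the right subtree, which \<open>a\<close>
  splits after position \<open>k\<close>. A cut before \<open>a\<close> is a cut of \<open>u\<close>. A cut beyond \<open>a\<close> is a
  cut of \<open>w\<close> beyond which all letters exceed \<open>a\<close>, which happens from position \<open>k\<close> on.
\<close>

lemma cuts_append:
  fixes a :: "'a :: linorder"
  assumes less: "\<forall>x\<in>set u. \<forall>y\<in>set w. x < y" and max: "\<forall>x\<in>set u. x < a"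
    and k: "k \<le> length w" and small: "\<forall>x\<in>set (take k w). x < a" and large: "\<forall>x\<in>set (drop k w). a < x"
  shows "cuts (u @ [a] @ w) = cuts u \<union> (+) (Suc (length u)) ` {j \<in> cuts w. k \<le> j}"
proof -
  have left: "i \<in> cuts (u @ [a] @ w) \<longleftrightarrow> i \<in> cuts u" if "i \<le> length u" for i
    using that less max by (auto simp: cuts_def dest: in_set_takeD)
  have right: "Suc (length u) + j \<in> cuts (u @ [a] @ w) \<longleftrightarrow> j \<in> cuts w \<and> k \<le> j" for j
  proof (cases "k \<le> j")
    case True
    then have "set (drop j w) \<subseteq> set (drop k w)"
      by (rule set_drop_subset_set_drop)
    then have "\<forall>y\<in>set (drop j w). a < y" "\<forall>x\<in>set u. \<forall>y\<in>set (drop j w). x < y"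
      using large less by (auto dest: in_set_dropD)
    with True show ?thesis by (auto simp: cuts_def)
  next
    case False
    with k have "j < length w" by simp
    then have "w ! j \<in> set (drop j w)"
      by (metis Cons_nth_drop_Suc list.set_intros(1))
    moreover have "w ! j \<in> set (take k w)"
      using False k by (auto simp: in_set_conv_nth intro!: exI[of _ j])
    ultimately have "\<not> (\<forall>y\<in>set (drop j w). a < y)"
      using small by (meson order_less_asym)
    with False show ?thesis
      by (auto simp: cuts_def)
  qed
  have "i \<in> cuts (u @ [a] @ w) \<longleftrightarrow>
      i \<in> cuts u \<or> i \<in> (+) (Suc (length u)) ` {j \<in> cuts w. k \<le> j}" for i
  proof (cases "i \<le> length u")
    case True
    then show ?thesis using left by auto
  next
    case False
    then obtain j where j: "i = Suc (length u) + j"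
      by (metis add_Suc less_iff_Suc_add not_le)
    have "i \<notin> cuts u" using False by (simp add: cuts_def)
    then show ?thesis unfolding j using right[of j] by auto
  qed
  then show ?thesis by blast
qed

text \<open>
  The cut at the end of \<open>u @ [a]\<close> survives only if \<open>k = 0\<close>, and then it is counted as the cut \<open>0\<close> of
  \<open>w\<close>. The cut behind the final letter \<open>m\<close> takes its place, so the numbers balance exactly.
\<close>

lemma card_cuts_append:
  fixes a :: "'a :: linorder"
  assumes "\<forall>x\<in>set u. \<forall>y\<in>set w. x < y" "\<forall>x\<in>set u. x < a"
    and "k \<le> length w" "\<forall>x\<in>set (take k w). x < a" "\<forall>x\<in>set (drop k w). a < x"
    and m: "\<forall>x\<in>set (u @ [a] @ w). x < m"
  shows "card (cuts ((u @ [a]) @ w @ [m])) = card (cuts (u @ [a])) + card {j \<in> cuts w. k \<le> j}"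
proof -
  have bound: "i \<le> length v" if "i \<in> cuts v" for i and v :: "'a list"
    using that by (simp add: cuts_def)
  let ?R = "(+) (Suc (length u)) ` {j \<in> cuts w. k \<le> j}"
  have "cuts ((u @ [a] @ w) @ [m]) = insert (Suc (length (u @ [a] @ w))) (cuts u \<union> ?R)"
    unfolding cuts_snoc_max[OF m] cuts_append[OF assms(1-5)] ..
  moreover have "Suc (length (u @ [a] @ w)) \<notin> cuts u \<union> ?R"
    using bound by fastforce
  moreover have "cuts u \<inter> ?R = {}"
    using bound[of _ u] by fastforce
  moreover have "card ?R = card {j \<in> cuts w. k \<le> j}"
    by (rule card_image) simp
  ultimately have "card (cuts ((u @ [a] @ w) @ [m])) = Suc (card (cuts u) + card {j \<in> cuts w. k \<le> j})"
    by (simp add: card_Un_disjoint)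
  moreover have "card (cuts (u @ [a])) = Suc (card (cuts u))"
    using bound[of "Suc (length u)" u] by (subst cuts_snoc_max[OF assms(2)]) (auto simp: card_insert_if)
  ultimately show ?thesis by simp
qed

lemma avoids231_append_split:
  assumes less: "\<forall>x\<in>set u. \<forall>y\<in>set w. x < y"
    and small: "\<forall>x\<in>set (take k w). x < a" and large: "\<forall>x\<in>set (drop k w). a < x"
    and m: "\<forall>x\<in>set (u @ [a] @ w). x < m"
    and "avoids231 (u @ [a])" "avoids231 w"
  shows "avoids231 ((u @ [a]) @ w @ [m])"
proof -
  have "\<not> (z < x \<and> x < y)" if "subseq [x, y] (u @ [a])" "z \<in> set w" for x y z
  proof -
    have "x \<in> set u"
      using that(1) set_subset_of_subseq[of "[x, y]" u] unfolding subseq2_append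
      by (auto split: if_splits)
    with less that(2) have "x < z" by blast
    then show ?thesis by auto
  qed
  moreover have "\<not> (z < x \<and> x < y)" if x: "x \<in> set (u @ [a])" and yz: "subseq [y, z] w" for x y z
  proof (cases "x = a")
    case True
    have "subseq [y, z] (take k w @ drop k w)" using yz by simp
    then have "y \<in> set (take k w) \<or> z \<in> set (drop k w)"
      unfolding subseq2_append
      using set_subset_of_subseq[of "[y, z]" "take k w"] set_subset_of_subseq[of "[y, z]" "drop k w"]
      by auto
    then show ?thesis
      using small large True by (auto dest!: bspec)
  next
    case False
    with x less set_subset_of_subseq[OF yz] have "x < z" by auto
    then show ?thesis by auto
  qed
  ultimately have "avoids231 ((u @ [a]) @ w)"
    using assms by (subst avoids231_append) blast
  moreover have "\<forall>x\<in>set ((u @ [a]) @ w). x < m" using m by simp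
  ultimately show ?thesis
    using avoids231_snoc_max[of "(u @ [a]) @ w" m] by simp
qed

text \<open>
  The value \<open>a\<close> precedes \<open>w\<close> in the reading; if no letter of \<open>w\<close> above \<open>a\<close> is
  followed, at any distance, by one below \<open>a\<close>, then the letters below \<open>a\<close> all come first.
\<close>

lemma split_of_no_descent_across:
  fixes a :: "'a :: linorder"
  assumes "\<forall>y z. subseq [y, z] w \<longrightarrow> \<not> (z < a \<and> a < y)" and "a \<notin> set w"
  shows "w = filter (\<lambda>x. x < a) w @ filter (\<lambda>x. a < x) w"
  using assms
proof (induction w)
  case (Cons y w)
  have yw: "\<not> (z < a \<and> a < y)" if "z \<in> set w" for z
    using Cons.prems(1) that by (metis subseq_Cons2 subseq_singleton_left)
  have "subseq [y', z] (y # w)" if "subseq [y', z] w" for y' z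
    using that by (rule list_emb_Cons)
  then have IH: "w = filter (\<lambda>x. x < a) w @ filter (\<lambda>x. a < x) w"
    using Cons by (metis list.set_intros(2))
  show ?case
  proof (cases "y < a")
    case True
    then have "\<not> a < y" by (rule order_less_not_sym)
    with True show ?thesis by (simp add: IH[symmetric])
  next
    case False
    then have "a < y" using Cons.prems(2) by auto
    then have "filter (\<lambda>x. x < a) w = []"
      using yw by (auto simp: filter_empty_conv)
    with IH[symmetric] \<open>a < y\<close> show ?thesis by simp
  qed
qed simp

lemma initial_segment_eq:
  fixes A :: "nat set"
  assumes "A \<subseteq> {1..n}" and "\<forall>x\<in>A. \<forall>y\<in>{1..n} - A. x < y"
  shows "A = {1..card A}"
proof -
  have fin: "finite A" using assms(1) finite_subset by blast
  have down: "y \<in> A" if "x \<in> A" "1 \<le> y" "y \<le> x" for x y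
  proof (rule ccontr)
    assume "y \<notin> A"
    moreover have "x \<le> n" using assms(1) that(1) by auto
    ultimately have "x < y" using assms(2) that by auto
    with that(3) show False by simp
  qed
  show ?thesis
  proof (cases "A = {}")
    case False
    then have "Max A \<in> A" using fin by simp
    then have "A = {1..Max A}"
      using down fin assms(1) by auto
    then show ?thesis by (metis card_atLeastAtMost diff_Suc_1)
  qed simp
qed

text \<open>
  The number of elements of \<open>C\<close> that are at least \<open>k\<close> runs through each of \<open>1, \<dots>, card C\<close>
  once; this is the step that produces the geometric sums of the functional equation.
\<close>

lemma sum_card_above:
  fixes C :: "nat set" and f :: "nat \<Rightarrow> 'a :: comm_monoid_add"
  assumes "finite C"
  shows "(\<Sum>k\<in>C. f (card {j \<in> C. k \<le> j})) = (\<Sum>e = 1..card C. f e)"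
  using assms
proof (induction rule: finite_linorder_min_induct)
  case (insert b A)
  have "{j \<in> insert b A. k \<le> j} = {j \<in> A. k \<le> j}" if "k \<in> A" for k
    using insert.hyps that by auto
  moreover have "{j \<in> insert b A. b \<le> j} = insert b A"
    using insert.hyps by auto
  moreover have "b \<notin> A" using insert.hyps by auto
  ultimately show ?case
    using insert by (simp add: add.commute)
qed simp

section \<open>Decomposing a tree at its root\<close>

lemma only_children_left_map_tree [simp]:
  "only_children_left (map_tree f t) \<longleftrightarrow> only_children_left t"
  by (induction t) auto

lemma decreasing_labels_map_tree:
  "strict_mono f \<Longrightarrow> decreasing_labels (map_tree f t) \<longleftrightarrow> decreasing_labels t"
  by (induction t) (simp_all add: decreasing_labels_Node tree.set_map ball_Un strict_mono_less)

text \<open>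
  When a left subtree with \<open>l\<close> vertices and a right subtree are put together along a cut \<open>k\<close>, the
  labels \<open>1, \<dots>, l - 1\<close> of the left one stay, its root label \<open>l\<close> moves up to \<open>l + k\<close>, and the labels
  of the right one fill the remaining gap and the values above. Both relabellings are strictly
  increasing on all natural numbers, hence injective there; for the right one this holds for
  \<open>l = 0\<close> as well, by truncated subtraction.
\<close>

definition relabel_left :: "nat \<Rightarrow> nat \<Rightarrow> nat \<Rightarrow> nat" where
  "relabel_left l k x = (if x < l then x else x + k)"

definition relabel_right :: "nat \<Rightarrow> nat \<Rightarrow> nat \<Rightarrow> nat" where
  "relabel_right l k y = (if y \<le> k then y + (l - 1) else y + l)"

lemma strict_mono_relabel_left: "strict_mono (relabel_left l k)"
  by (auto simp: strict_mono_def relabel_left_def)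

lemma strict_mono_relabel_right: "strict_mono (relabel_right l k)"
  by (auto simp: strict_mono_def relabel_right_def)

lemma image_relabel_left:
  assumes "1 \<le> l"
  shows "relabel_left l k ` {1..l} = insert (l + k) {1..<l}"
proof -
  have "{1..l} = insert l {1..<l}" using assms by auto
  moreover have "relabel_left l k ` {1..<l} = {1..<l}"
    by (auto simp: relabel_left_def image_iff)
  moreover have "relabel_left l k l = l + k"
    by (simp add: relabel_left_def)
  ultimately show ?thesis by simp
qed

lemma image_relabel_right:
  assumes "1 \<le> l" "k \<le> r"
  shows "relabel_right l k ` {1..r} = {l..l + r} - {l + k}"
proof (intro equalityI subsetI)
  fix y assume "y \<in> relabel_right l k ` {1..r}"
  then show "y \<in> {l..l + r} - {l + k}"
    using assms by (auto simp: relabel_right_def split: if_splits)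
next
  fix y assume y: "y \<in> {l..l + r} - {l + k}"
  show "y \<in> relabel_right l k ` {1..r}"
  proof (cases "y < l + k")
    case True
    then show ?thesis
      using y assms by (intro image_eqI[of _ _ "y - (l - 1)"]) (auto simp: relabel_right_def)
  next
    case False
    then show ?thesis
      using y assms by (intro image_eqI[of _ _ "y - l"]) (auto simp: relabel_right_def)
  qed
qed

definition glue :: "nat tree \<Rightarrow> nat \<Rightarrow> nat tree \<Rightarrow> nat tree" where
  "glue L k R = Node (map_tree (relabel_left (size L) k) L) (Suc (size L + size R))
                     (map_tree (relabel_right (size L) k) R)"

lemma postorder_av_tree:
  assumes "t \<in> av_trees n" and "n \<noteq> 0"
  obtains u where "postorder t = u @ [n]" and "set u = {1..<n}"
proof -
  obtain l a r where t: "t = Node l a r"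
    using assms by (cases t) (auto simp: av_trees_def)
  have less: "\<forall>x\<in>set_tree l \<union> set_tree r. x < a"
    and set: "insert a (set_tree l \<union> set_tree r) = {1..n}"
    using assms(1) by (simp_all add: av_trees_def t decreasing_labels_Node)
  have "n \<in> insert a (set_tree l \<union> set_tree r)" "a \<in> {1..n}"
    using assms(2) set by auto
  then have a: "a = n" using less by (metis Un_iff atLeastAtMost_iff insertE leD)
  have "set_tree l \<union> set_tree r = {1..n} - {n}"
    using set less unfolding a by blast
  also have "\<dots> = {1..<n}" by auto
  finally show thesis
    by (intro that[of "postorder l @ postorder r"]) (simp_all add: t a)
qed

text \<open>
  In a permutation a cut at position \<open>k\<close> also splits the values at \<open>k\<close>.
\<close>

lemma cut_of_perm:
  assumes w: "distinct w" "set w = {1..r}" and k: "k \<in> cuts w"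
  shows "k \<le> r" and "set (take k w) = {1..k}" and "set (drop k w) = {Suc k..r}"
proof -
  have len: "length w = r" using w distinct_card[of w] by simp
  with k show "k \<le> r" by (simp add: cuts_def)
  have un: "set (take k w) \<union> set (drop k w) = {1..r}"
    by (metis append_take_drop_id set_append w(2))
  have dis: "set (take k w) \<inter> set (drop k w) = {}"
    using w(1) by (simp add: set_take_disj_set_drop_if_distinct)
  have card: "card (set (take k w)) = k"
    using w(1) len \<open>k \<le> r\<close> by (simp add: distinct_card)
  have compl: "set (drop k w) = {1..r} - set (take k w)"
    using un dis by blast
  then have "set (take k w) = {1..card (set (take k w))}"
    using k un compl by (intro initial_segment_eq[of _ r]) (auto simp: cuts_def)
  then show take: "set (take k w) = {1..k}" by (simp add: card)
  show "set (drop k w) = {Suc k..r}"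
    unfolding compl take by auto
qed

definition n_cuts :: "nat tree \<Rightarrow> nat" where
  "n_cuts t = card (cuts (postorder t))"

lemma glue_av_trees:
  assumes L: "L \<in> av_trees l" and R: "R \<in> av_trees r" and LR: "L = Leaf \<longrightarrow> R = Leaf"
    and k: "k \<in> cuts (postorder R)"
  shows "glue L k R \<in> av_trees (Suc (l + r))"
    and "n_cuts (glue L k R) = n_cuts L + card {j \<in> cuts (postorder R). k \<le> j}"
proof -
  have size: "size L = l" "size R = r"
    using L R by (simp_all add: size_av_trees)
  have "glue L k R \<in> av_trees (Suc (l + r)) \<and>
      n_cuts (glue L k R) = n_cuts L + card {j \<in> cuts (postorder R). k \<le> j}"
  proof (cases "l = 0")
    case True
    then have "L = Leaf" "R = Leaf" "r = 0" "k = 0"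
      using L R LR k by (auto simp: Leaf_in_av_trees_iff)
    moreover have "{j. j = 0 \<and> 0 \<le> j} = {0::nat}" by auto
    ultimately show ?thesis
      using True cuts_snoc_max[of "[]" "Suc 0"]
      by (simp add: glue_def av_trees_def decreasing_labels_Node n_cuts_def)
  next
    case False
    define f where "f = relabel_left l k"
    define g where "g = relabel_right l k"
    have mono: "strict_mono f" "strict_mono g"
      by (simp_all add: f_def g_def strict_mono_relabel_left strict_mono_relabel_right)
    have w: "distinct (postorder R)" "set (postorder R) = {1..r}"
      using R by (simp_all add: av_trees_def distinct_postorder)
    note cut = cut_of_perm[OF w k]
    have imf: "f ` {1..l} = insert (l + k) {1..<l}" and img: "g ` {1..r} = {l..l + r} - {l + k}"
      using image_relabel_left[of l k] image_relabel_right[OF _ cut(1), of l] False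
      by (simp_all add: f_def g_def)
    obtain u0 where u0: "postorder L = u0 @ [l]" "set u0 = {1..<l}"
      using postorder_av_tree[OF L False] .
    have fl: "f l = l + k" and fu: "f ` {1..<l} = {1..<l}"
      by (auto simp: f_def relabel_left_def image_iff)
    define u where "u = map f u0"
    define v where "v = map g (postorder R)"
    define m where "m = Suc (l + r)"
    have pL: "postorder (map_tree f L) = u @ [l + k]"
      by (simp add: postorder_map u0 u_def fl)
    have pR: "postorder (map_tree g R) = v"
      by (simp add: postorder_map v_def)
    have glue: "glue L k R = Node (map_tree f L) m (map_tree g R)"
      by (simp add: glue_def size f_def g_def m_def)
    have post: "postorder (glue L k R) = (u @ [l + k]) @ v @ [m]"
      by (simp add: glue pL pR)
    have setu: "set u = {1..<l}" unfolding u_def set_map u0 fu ..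
    have setv: "set v = {l..l + r} - {l + k}" unfolding v_def set_map w img ..
    have less: "\<forall>x\<in>set u. \<forall>y\<in>set v. x < y" "\<forall>x\<in>set u. x < l + k"
      by (auto simp: setu setv)
    have kv: "k \<le> length v"
      using k by (simp add: v_def cuts_def)
    have small: "\<forall>x\<in>set (take k v). x < l + k" and large: "\<forall>x\<in>set (drop k v). l + k < x"
      using cut False by (auto simp: v_def take_map drop_map g_def relabel_right_def)
    have below: "\<forall>x\<in>set (u @ [l + k] @ v). x < m"
      using cut(1) by (auto simp: setu setv m_def)
    have av: "avoids231 (u @ [l + k])" "avoids231 v"
      using L R mono by (simp_all add: av_trees_def avoids231_map v_def flip: pL add: postorder_map)
    have "avoids231 (postorder (glue L k R))"
      unfolding post using less(1) small large below av by (rule avoids231_append_split)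
    moreover have "decreasing_labels (glue L k R)"
    proof -
      have "set_tree (map_tree f L) = set (u @ [l + k])" "set_tree (map_tree g R) = set v"
        by (metis pL set_postorder) (metis pR set_postorder)
      then show ?thesis
        using below L R mono
        by (auto simp: glue decreasing_labels_Node decreasing_labels_map_tree av_trees_def)
    qed
    moreover have "distinct (postorder (glue L k R))"
    proof -
      have "distinct (u @ [l + k])" "distinct v"
        using L w mono by (auto simp flip: pL pR simp: postorder_map distinct_map av_trees_def
            distinct_postorder strict_mono_imp_inj_on intro: inj_on_subset)
      then show ?thesis
        using below by (auto simp: post setu setv m_def)
    qed
    moreover have "set (postorder (glue L k R)) = {1..m}"
      using cut(1) False by (auto simp: post setu setv m_def)
    moreover have "only_children_left (glue L k R)"
      using L R LR by (auto simp: glue av_trees_def)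
    ultimately have "glue L k R \<in> av_trees (Suc (l + r))"
      by (simp only: av_trees_def set_postorder distinct_postorder m_def mem_Collect_eq simp_thms)
    moreover have "n_cuts (glue L k R) = n_cuts L + card {j \<in> cuts (postorder R). k \<le> j}"
    proof -
      have "cuts (u @ [l + k]) = cuts (postorder L)" "cuts v = cuts (postorder R)"
        using mono by (simp_all add: cuts_map v_def flip: pL add: postorder_map)
      then show ?thesis
        using card_cuts_append[OF less kv small large below] by (simp add: n_cuts_def post)
    qed
    ultimately show ?thesis by blast
  qed
  then show "glue L k R \<in> av_trees (Suc (l + r))"
    and "n_cuts (glue L k R) = n_cuts L + card {j \<in> cuts (postorder R). k \<le> j}"
    by blast+
qed

text \<open>
  The sizes of the subtrees can be read off, then \<open>k\<close> from the largest label \<open>l + k\<close> of the left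
  subtree; an empty left subtree forces \<open>k = 0\<close> because then the right subtree is empty, too.
\<close>

lemma glue_inject:
  assumes "L \<in> av_trees l" "R \<in> av_trees r" "k \<in> cuts (postorder R)" "L = Leaf \<longrightarrow> R = Leaf"
    and "L' \<in> av_trees l'" "R' \<in> av_trees r'" "k' \<in> cuts (postorder R')" "L' = Leaf \<longrightarrow> R' = Leaf"
    and eq: "glue L k R = glue L' k' R'"
  shows "L = L' \<and> k = k' \<and> R = R'"
proof -
  have "size L = size L'"
    using arg_cong[OF eq, of "size \<circ> left"] by (simp add: glue_def)
  then have l: "size L = l" "size L' = l" "l' = l"
    using assms by (auto simp: size_av_trees)
  have eqL: "map_tree (relabel_left l k) L = map_tree (relabel_left l k') L'"
    and eqR: "map_tree (relabel_right l k) R = map_tree (relabel_right l k') R'"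
    using eq by (simp_all add: glue_def l)
  have k: "k = k'"
  proof (cases "l = 0")
    case True
    then show ?thesis using assms l by auto
  next
    case False
    have "relabel_left l k ` {1..l} = relabel_left l k' ` {1..l}"
      using arg_cong[OF eqL, of set_tree] assms(1,5) l(3) by (simp add: tree.set_map av_trees_def)
    then have "insert (l + k) {1..<l} = insert (l + k') {1..<l}"
      using image_relabel_left[of l k] image_relabel_left[of l k'] False by simp
    then have "l + k \<in> insert (l + k') {1..<l}" by blast
    then show ?thesis by auto
  qed
  have "inj (map_tree (relabel_left l k))" "inj (map_tree (relabel_right l k))"
    by (intro tree.inj_map strict_mono_imp_inj_on strict_mono_relabel_left strict_mono_relabel_right)+
  with eqL eqR k show ?thesis by (auto dest: injD)
qed

text \<open>
  Standardization: the labels of \<open>t\<close> are pulled back along \<open>f\<close>.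
\<close>

lemma av_tree_relabel:
  assumes f: "strict_mono f" and set: "set_tree t = f ` {1..n}"
    and t: "only_children_left t" "decreasing_labels t" "distinct (inorder t)" "avoids231 (postorder t)"
  obtains s where "s \<in> av_trees n" and "t = map_tree f s"
proof -
  have inj: "inj f" using f by (rule strict_mono_imp_inj_on)
  have "map_tree f (map_tree (inv f) t) = map_tree id t"
    unfolding tree.map_comp
    by (rule tree.map_cong0) (use set in \<open>auto simp: inv_f_f[OF inj]\<close>)
  then obtain s where s: "t = map_tree f s"
    by (metis tree.map_id)
  have "f ` set_tree s = f ` {1..n}"
    using set by (simp add: s tree.set_map)
  then have "set_tree s = {1..n}"
    using inj by (simp add: inj_image_eq_iff)
  then have "s \<in> av_trees n"
    using t f by (simp add: s av_trees_def decreasing_labels_map_tree inorder_map postorder_map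
        avoids231_map distinct_map)
  with s that show thesis by blast
qed

text \<open>
  Let \<open>u\<close>, followed by the root label \<open>a\<close>, be the reading of the left subtree, and \<open>w\<close> that of the
  right one. A letter of \<open>w\<close> below some \<open>x\<close> in \<open>u\<close> would complete the pair \<open>x, a\<close> to a 231, so \<open>u\<close>
  lies below \<open>w\<close>. A descent of \<open>w\<close> across \<open>a\<close> would complete \<open>a\<close> to a 231, so the letters of \<open>w\<close>
  below \<open>a\<close> form a prefix, whose length is the cut \<open>k\<close>. Both \<open>u\<close> and \<open>u\<close> with this prefix and \<open>a\<close>
  consist of the smallest values available, which determines all labels.
\<close>

lemma glue_surj:
  assumes T: "T \<in> av_trees (Suc n)"
  obtains l r L k R where "l + r = n" "L \<in> av_trees l" "R \<in> av_trees r"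
    "L = Leaf \<longrightarrow> R = Leaf" "k \<in> cuts (postorder R)" "T = glue L k R"
proof -
  obtain TL m TR where T_eq: "T = Node TL m TR"
    using T by (cases T) (auto simp: Leaf_in_av_trees_iff)
  define l r where "l = size TL" and "r = size TR"
  have "size T = Suc n" using T by (rule size_av_trees)
  then have n: "l + r = n" by (simp add: T_eq l_def r_def)
  have parts: "only_children_left TL" "only_children_left TR" "TL = Leaf \<longrightarrow> TR = Leaf"
    "decreasing_labels TL" "decreasing_labels TR" "\<forall>x\<in>set_tree TL \<union> set_tree TR. x < m"
    "distinct (inorder TL)" "distinct (inorder TR)" "set_tree TL \<inter> set_tree TR = {}"
    "insert m (set_tree TL \<union> set_tree TR) = {1..Suc n}"
    "avoids231 (postorder TL @ postorder TR @ [m])"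
    using T by (auto simp: av_trees_def T_eq decreasing_labels_Node)
  have m: "m = Suc n"
  proof -
    have "Suc n \<in> insert m (set_tree TL \<union> set_tree TR)" "m \<in> {1..Suc n}"
      using parts(10) by auto
    then show ?thesis using parts(6) by (metis Un_iff atLeastAtMost_iff insertE leD)
  qed
  have un: "set_tree TL \<union> set_tree TR = {1..n}"
  proof -
    have "set_tree TL \<union> set_tree TR = {1..Suc n} - {m}" using parts(6,10) by blast
    also have "\<dots> = {1..n}" unfolding m by auto
    finally show ?thesis .
  qed
  show thesis
  proof (cases TL)
    case Leaf
    then have "TR = Leaf" "n = 0" using parts(3) n by (auto simp: l_def r_def)
    then show thesis
      using Leaf by (intro that[of 0 0 Leaf Leaf 0]) (simp_all add: T_eq m glue_def)
  next
    case (Node l1 a r1)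
    define u where "u = postorder l1 @ postorder r1"
    define w where "w = postorder TR"
    have pL: "postorder TL = u @ [a]" by (simp add: Node u_def)
    have ua: "\<forall>x\<in>set u. x < a" using parts(4) by (simp add: Node decreasing_labels_Node u_def)
    have setL: "set_tree TL = insert a (set u)"
      using set_postorder[of TL] by (simp add: pL)
    have setR: "set_tree TR = set w" by (simp add: w_def)
    have aw: "a \<notin> set w" using parts(9) by (auto simp: setL setR)
    have dist: "distinct u" "distinct w"
      using parts(7,8) distinct_postorder[of TL] distinct_postorder[of TR]
      by (simp_all add: pL w_def)
    have av: "avoids231 (postorder TL @ postorder TR @ [m])" by (rule parts(11))
    have uw: "\<forall>x\<in>set u. \<forall>y\<in>set w. x < y"
    proof (intro ballI)
      fix x y assume xy: "x \<in> set u" "y \<in> set w"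
      then have "subseq [x, a] (u @ [a])" unfolding subseq2_append by simp
      moreover have "y \<in> set (w @ [m])" using xy by simp
      ultimately have "\<not> (y < x \<and> x < a)"
        using av avoids231_append[of "u @ [a]" "w @ [m]"] by (simp add: pL w_def) blast
      moreover have "x \<noteq> y" using parts(9) xy by (auto simp: setL setR)
      ultimately show "x < y" using ua xy by auto
    qed
    have across: "\<forall>y z. subseq [y, z] w \<longrightarrow> \<not> (z < a \<and> a < y)"
    proof (intro allI impI)
      fix y z assume "subseq [y, z] w"
      then have "subseq [y, z] (w @ [m])" unfolding subseq2_append by simp
      moreover have "a \<in> set (u @ [a])" by simp
      ultimately show "\<not> (z < a \<and> a < y)"
        using av avoids231_append[of "u @ [a]" "w @ [m]"] by (simp add: pL w_def)
    qed
    define k where "k = length (filter (\<lambda>x. x < a) w)"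
    have w_eq: "w = filter (\<lambda>x. x < a) w @ filter (\<lambda>x. a < x) w"
      by (rule split_of_no_descent_across[OF across aw])
    have take: "take k w = filter (\<lambda>x. x < a) w" and drop: "drop k w = filter (\<lambda>x. a < x) w"
      using w_eq unfolding k_def by (metis append_eq_conv_conj)+
    have kw: "k \<le> length w" by (simp add: k_def)
    have cut: "k \<in> cuts w"
      unfolding cuts_def using kw by (simp add: take drop)
    have l: "l = Suc (length u)"
      using length_postorder[of TL] by (simp add: pL l_def)
    have r: "r = length w" by (simp add: w_def r_def)
    have all: "insert a (set u \<union> set w) = {1..n}"
      using un by (auto simp: setL setR)
    have setu: "set u = {1..<l}"
    proof -
      have "set u = {1..card (set u)}"
        by (rule initial_segment_eq[of _ n]) (use all ua uw in auto)
      also have "\<dots> = {1..<l}"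
        using dist(1) by (simp add: distinct_card l atLeastLessThanSuc_atLeastAtMost)
      finally show ?thesis .
    qed
    define S where "S = set u \<union> set (take k w)"
    have card_S: "card S = length u + k"
    proof -
      have "set u \<inter> set (take k w) = {}" using uw by (fastforce dest: in_set_takeD)
      then show ?thesis
        using dist kw unfolding S_def by (subst card_Un_disjoint) (simp_all add: distinct_card)
    qed
    have a_S: "a \<notin> S" and "finite S"
      using ua by (auto simp: S_def take)
    then have card_aS: "card (insert a S) = Suc (length u + k)" by (simp add: card_S)
    have S_le: "insert a S \<subseteq> {1..n}"
      unfolding all[symmetric] S_def take by auto
    have "S = {1..card S}"
    proof (rule initial_segment_eq[of _ n])
      show "S \<subseteq> {1..n}" using S_le by blast
      show "\<forall>x\<in>S. \<forall>y\<in>{1..n} - S. x < y"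
        unfolding all[symmetric] S_def take using ua uw aw by (auto intro: order_less_trans)
    qed
    moreover have "insert a S = {1..card (insert a S)}"
    proof (rule initial_segment_eq[of _ n])
      show "insert a S \<subseteq> {1..n}" by (rule S_le)
      show "\<forall>x\<in>insert a S. \<forall>y\<in>{1..n} - insert a S. x < y"
        unfolding all[symmetric] S_def take using ua uw aw by (auto intro: order_less_trans)
    qed
    ultimately have "a \<in> {1..Suc (length u + k)}" "a \<notin> {1..length u + k}"
      using a_S unfolding card_S card_aS by blast+
    then have a: "a = l + k" using l by auto
    have "1 \<le> l" "k \<le> r" using l r kw by simp_all
    note im = image_relabel_left[OF this(1), of k] image_relabel_right[OF this]
    have sL: "set_tree TL = relabel_left l k ` {1..l}"
      unfolding im setL a setu ..
    have "set w = {1..n} - insert a (set u)"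
      using all uw ua aw by auto
    also have "\<dots> = {l..l + r} - {l + k}"
      unfolding setu a using n \<open>1 \<le> l\<close> by auto
    finally have sR: "set_tree TR = relabel_right l k ` {1..r}"
      unfolding im setR .
    have avL: "avoids231 (postorder TL)" and avR: "avoids231 (postorder TR)"
      using av by (simp_all add: avoids231_append)
    obtain L where L: "L \<in> av_trees l" "TL = map_tree (relabel_left l k) L"
      by (rule av_tree_relabel[OF strict_mono_relabel_left sL parts(1,4,7) avL])
    obtain R where R: "R \<in> av_trees r" "TR = map_tree (relabel_right l k) R"
      by (rule av_tree_relabel[OF strict_mono_relabel_right sR parts(2,5,8) avR])
    show thesis
    proof (rule that[of l r L R k])
      show "l + r = n" "L \<in> av_trees l" "R \<in> av_trees r" by fact+
      show "L = Leaf \<longrightarrow> R = Leaf" using parts(3) L R by simp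
      show "k \<in> cuts (postorder R)"
        using cut unfolding w_def R postorder_map cuts_map[OF strict_mono_relabel_right] .
      show "T = glue L k R"
        using n L R by (simp add: T_eq glue_def m size_av_trees)
    qed
  qed
qed

section \<open>The recurrence for the cut weights\<close>

text \<open>
  The coefficient of \<open>z\<^sup>n\<close> in the generating function, with the variable \<open>x\<close> that marks cuts already
  evaluated at a ring element. No polynomials in \<open>x\<close> are needed this way, and \<open>x\<close> may later be a
  power series in \<open>z\<close> itself.
\<close>

definition weight :: "'a :: comm_ring_1 \<Rightarrow> nat \<Rightarrow> 'a" where
  "weight x n = (\<Sum>t\<in>av_trees n. x ^ n_cuts t)"

lemma weight_0 [simp]: "weight x 0 = x"
  by (simp add: weight_def n_cuts_def)

lemma bij_betw_glue:
  "bij_betw (\<lambda>(i, L, R, k). glue L k R)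
     (SIGMA i:{..n}. SIGMA L:av_trees i. SIGMA R:{R \<in> av_trees (n - i). L = Leaf \<longrightarrow> R = Leaf}.
        cuts (postorder R))
     (av_trees (Suc n))" (is "bij_betw ?g ?D _")
  unfolding bij_betw_def
proof
  show "inj_on ?g ?D"
  proof (rule inj_onI)
    fix p p' assume pp': "p \<in> ?D" "p' \<in> ?D" "?g p = ?g p'"
    obtain i L R k where p: "p = (i, L, R, k)" by (metis surj_pair)
    obtain i' L' R' k' where p': "p' = (i', L', R', k')" by (metis surj_pair)
    have *: "L \<in> av_trees i" "R \<in> av_trees (n - i)" "k \<in> cuts (postorder R)" "L = Leaf \<longrightarrow> R = Leaf"
      "L' \<in> av_trees i'" "R' \<in> av_trees (n - i')" "k' \<in> cuts (postorder R')" "L' = Leaf \<longrightarrow> R' = Leaf"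
      "glue L k R = glue L' k' R'"
      using pp' by (auto simp: p p')
    have "L = L' \<and> k = k' \<and> R = R'"
      by (rule glue_inject) fact+
    moreover from this have "i = i'"
      using *(1,5) size_av_trees by blast
    ultimately show "p = p'" by (simp add: p p')
  qed
  show "?g ` ?D = av_trees (Suc n)"
  proof (intro equalityI subsetI)
    fix T assume "T \<in> ?g ` ?D"
    then obtain i L R k where "i \<le> n" "L \<in> av_trees i" "R \<in> av_trees (n - i)"
      "L = Leaf \<longrightarrow> R = Leaf" "k \<in> cuts (postorder R)" "T = glue L k R"
      by auto
    then show "T \<in> av_trees (Suc n)"
      using glue_av_trees(1)[of L i R "n - i" k] by simp
  next
    fix T assume "T \<in> av_trees (Suc n)"
    then obtain l r L k R where "l + r = n" "L \<in> av_trees l" "R \<in> av_trees r"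
      "L = Leaf \<longrightarrow> R = Leaf" "k \<in> cuts (postorder R)" "T = glue L k R"
      by (rule glue_surj)
    then show "T \<in> ?g ` ?D"
      by (intro image_eqI[of _ _ "(l, L, R, k)"]) auto
  qed
qed

text \<open>
  The term for \<open>n = 0\<close> is the single vertex, which has two cuts. It is separate because an empty
  left subtree allows only an empty right one; hence \<open>i\<close>, the size of the left subtree, starts at 1.
\<close>

lemma weight_Suc:
  "weight x (Suc n) = (if n = 0 then x ^ 2 else 0) +
     (\<Sum>i = 1..n. weight x i * (\<Sum>R\<in>av_trees (n - i). \<Sum>e = 1..n_cuts R. x ^ e))"
proof -
  let ?Rs = "\<lambda>i (L :: nat tree). {R \<in> av_trees (n - i). L = Leaf \<longrightarrow> R = Leaf}"
  define c where "c L R k = x ^ (n_cuts L + card {j \<in> cuts (postorder R). k \<le> j})"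
    for L R :: "nat tree" and k
  define s where "s i = (\<Sum>L\<in>av_trees i. \<Sum>R\<in>?Rs i L. \<Sum>k\<in>cuts (postorder R). c L R k)" for i
  have c: "(\<Sum>k\<in>cuts (postorder R). c L R k) = x ^ n_cuts L * (\<Sum>e = 1..n_cuts R. x ^ e)" for L R
    using sum_card_above[of "cuts (postorder R)" "\<lambda>e. x ^ n_cuts L * x ^ e"]
    by (simp add: c_def power_add n_cuts_def sum_distrib_left)
  have "weight x (Suc n) = (\<Sum>(i, L, R, k)\<in>(SIGMA i:{..n}. SIGMA L:av_trees i.
      SIGMA R:?Rs i L. cuts (postorder R)). x ^ n_cuts (glue L k R))"
    unfolding weight_def
    by (subst sum.reindex_bij_betw[OF bij_betw_glue, symmetric]) (simp add: case_prod_unfold)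
  also have "\<dots> = (\<Sum>(i, L, R, k)\<in>(SIGMA i:{..n}. SIGMA L:av_trees i.
      SIGMA R:?Rs i L. cuts (postorder R)). c L R k)"
    by (rule sum.cong) (auto simp: c_def glue_av_trees(2))
  also have "\<dots> = (\<Sum>i\<le>n. s i)"
    unfolding s_def by (simp add: sum.Sigma finite_av_trees case_prod_unfold)
  also have "\<dots> = s 0 + (\<Sum>i = 1..n. s i)"
    by (simp add: sum.atMost_shift sum.atLeast1_atMost_eq)
  also have "s 0 = (if n = 0 then x ^ 2 else 0)"
  proof (cases "n = 0")
    case True
    then have "?Rs 0 Leaf = {Leaf}" by auto
    then show ?thesis
      using True by (simp add: s_def c_def n_cuts_def power2_eq_square)
  next
    case False
    then have empty: "?Rs 0 Leaf = {}" by (auto simp: Leaf_in_av_trees_iff)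
    have "s 0 = (\<Sum>R\<in>?Rs 0 Leaf. \<Sum>k\<in>cuts (postorder R). c Leaf R k)"
      by (simp add: s_def)
    then show ?thesis
      unfolding empty using False by simp
  qed
  also have "(\<Sum>i = 1..n. s i) =
      (\<Sum>i = 1..n. weight x i * (\<Sum>R\<in>av_trees (n - i). \<Sum>e = 1..n_cuts R. x ^ e))"
  proof (rule sum.cong)
    fix i assume "i \<in> {1..n}"
    then have "?Rs i L = av_trees (n - i)" if "L \<in> av_trees i" for L
      using that by (auto simp: Leaf_in_av_trees_iff)
    then show "s i = weight x i * (\<Sum>R\<in>av_trees (n - i). \<Sum>e = 1..n_cuts R. x ^ e)"
      by (simp add: s_def c weight_def sum_product)
  qed simp
  finally show ?thesis .
qed

text \<open>
  Multiplication by \<open>x - 1\<close> sums the geometric progressions; this is where the values at \<open>x = 1\<close>,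
  the unknown numbers of trees, enter.
\<close>

lemma weight_Suc_kernel:
  "(x - 1) * weight x (Suc n) = (if n = 0 then x ^ 2 * (x - 1) else 0) +
     x * (\<Sum>i = 1..n. weight x i * (weight x (n - i) - of_nat (card (av_trees (n - i)))))"
proof -
  have geometric: "(x - 1) * (\<Sum>e = 1..d. x ^ e) = x * (x ^ d - 1)" for d
    by (induction d) (simp_all add: algebra_simps)
  have "(x - 1) * (\<Sum>R\<in>av_trees m. \<Sum>e = 1..n_cuts R. x ^ e)
      = x * (weight x m - of_nat (card (av_trees m)))" for m
  proof -
    have "(x - 1) * (\<Sum>R\<in>av_trees m. \<Sum>e = 1..n_cuts R. x ^ e)
        = (\<Sum>R\<in>av_trees m. (x - 1) * (\<Sum>e = 1..n_cuts R. x ^ e))"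
      by (rule sum_distrib_left)
    also have "\<dots> = x * (weight x m - of_nat (card (av_trees m)))"
      by (simp only: geometric) (simp add: weight_def sum_subtractf flip: sum_distrib_left)
    finally show ?thesis .
  qed
  then have factor: "(x - 1) * (w * (\<Sum>R\<in>av_trees m. \<Sum>e = 1..n_cuts R. x ^ e))
      = x * (w * (weight x m - of_nat (card (av_trees m))))" for w m
    by (metis mult.left_commute)
  have "(x - 1) * (\<Sum>i = 1..n. weight x i * (\<Sum>R\<in>av_trees (n - i). \<Sum>e = 1..n_cuts R. x ^ e))
      = (\<Sum>i = 1..n. (x - 1) * (weight x i * (\<Sum>R\<in>av_trees (n - i). \<Sum>e = 1..n_cuts R. x ^ e)))"
    by (rule sum_distrib_left)
  also have "\<dots> = x * (\<Sum>i = 1..n. weight x i * (weight x (n - i) - of_nat (card (av_trees (n - i)))))"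
    unfolding factor by (rule sum_distrib_left[symmetric])
  finally show ?thesis
    unfolding weight_Suc distrib_left by (simp add: mult.commute)
qed

section \<open>Power series: fixed points and the diagonal\<close>

unbundle fps_syntax

lemma fps_X_power_dvd_iff:
  fixes f :: "'a :: comm_ring_1 fps"
  shows "fps_X ^ n dvd f \<longleftrightarrow> (\<forall>i<n. f $ i = 0)"
proof
  assume "\<forall>i<n. f $ i = 0"
  then have "f = fps_X ^ n * fps_shift n f"
    by (intro fps_ext) (simp add: fps_X_power_mult_nth)
  then show "fps_X ^ n dvd f" by (metis dvd_triv_left)
qed (auto simp: fps_X_power_mult_nth elim!: dvdE)

text \<open>
  The hypothesis says that \<open>\<Psi>\<close> does not increase the distance of two series in the adic metric, so
  that \<open>f \<mapsto> c + fps_X * \<Psi> f\<close> is a contraction. The limit of the iteration is built explicitly: the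
  coefficient of index \<open>n\<close> no longer changes after \<open>n + 1\<close> steps.
\<close>

lemma fps_fixed_point:
  fixes \<Psi> :: "'a :: comm_ring_1 fps \<Rightarrow> 'a fps"
  assumes \<Psi>: "\<And>f g. f - g dvd \<Psi> f - \<Psi> g"
  shows "\<exists>f. f = c + fps_X * \<Psi> f"
proof -
  define \<Phi> where "\<Phi> f = c + fps_X * \<Psi> f" for f
  have contr: "fps_X ^ Suc n dvd \<Phi> f - \<Phi> g" if "fps_X ^ n dvd f - g" for n f g
  proof -
    have "fps_X * fps_X ^ n dvd fps_X * (\<Psi> f - \<Psi> g)"
      by (intro mult_dvd_mono dvd_refl dvd_trans[OF that \<Psi>])
    then show ?thesis by (simp add: \<Phi>_def algebra_simps)
  qed
  define a where "a n = (\<Phi> ^^ n) 0" for n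
  have a_Suc: "a (Suc n) = \<Phi> (a n)" for n by (simp add: a_def)
  have step: "fps_X ^ n dvd a (Suc n) - a n" for n
    by (induction n) (use contr a_Suc in auto)
  have stable: "a m $ i = a n $ i" if "i < n" "n \<le> m" for i m n
    using that(2)
  proof (induction m rule: dec_induct)
    case (step m)
    have "(a (Suc m) - a m) $ i = 0"
      using \<open>\<And>n. fps_X ^ n dvd a (Suc n) - a n\<close>[of m] that(1) step.hyps
      unfolding fps_X_power_dvd_iff by simp
    with step.IH show ?case by simp
  qed simp
  define f where "f = Abs_fps (\<lambda>n. a (Suc n) $ n)"
  have f: "fps_X ^ n dvd f - a n" for n
    unfolding fps_X_power_dvd_iff
  proof (intro allI impI)
    fix i assume "i < n"
    then show "(f - a n) $ i = 0"
      using stable[of i "Suc i" n] by (simp add: f_def)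
  qed
  have "(f - \<Phi> f) $ n = 0" for n
  proof -
    have "fps_X ^ Suc n dvd (f - a (Suc n)) - (\<Phi> f - \<Phi> (a n))"
      by (intro dvd_diff contr f)
    then show ?thesis by (simp add: a_Suc fps_X_power_dvd_iff del: power_Suc)
  qed
  then have "f = \<Phi> f" by (auto simp: fps_eq_iff)
  then show ?thesis unfolding \<Phi>_def by blast
qed

text \<open>
  The inverse \<open>u\<close> is the fixed point of \<open>u \<mapsto> 1 - (f - 1) u\<close>.
\<close>

lemma fps_unit_of_nth_0_eq_1:
  fixes f :: "'a :: comm_ring_1 fps"
  assumes "f $ 0 = 1"
  obtains u where "f * u = 1"
proof -
  have f: "f = 1 + fps_X * fps_shift 1 f"
    by (intro fps_ext) (simp add: assms)
  obtain u where "u = 1 + fps_X * (- fps_shift 1 f * u)"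
    using fps_fixed_point[of "\<lambda>u. - fps_shift 1 f * u" 1]
    by (metis dvd_triv_right right_diff_distrib)
  then have "(1 + fps_X * fps_shift 1 f) * u = 1"
    by (simp add: algebra_simps)
  with f that show thesis by simp
qed

text \<open>
  The outer variable is replaced by the inner one: \<open>\<Sum>\<^sub>n F\<^sub>n t\<^sup>n\<close> goes to \<open>\<Sum>\<^sub>n F\<^sub>n fps_X\<^sup>n\<close>. With
  coefficients \<open>F\<^sub>n\<close> that depend on a series \<open>x\<close>, this evaluates a bivariate generating function
  at \<open>x\<close>. Like any evaluation, it is a ring homomorphism.
\<close>

definition fps_diagonal :: "'a :: comm_ring_1 fps fps \<Rightarrow> 'a fps" where
  "fps_diagonal F = Abs_fps (\<lambda>m. \<Sum>n\<le>m. F $ n $ (m - n))"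

lemma fps_diagonal_unfold:
  "fps_diagonal F = F $ 0 + fps_X * fps_diagonal (fps_shift 1 F)"
proof (rule fps_ext)
  fix m show "fps_diagonal F $ m = (F $ 0 + fps_X * fps_diagonal (fps_shift 1 F)) $ m"
    by (cases m) (simp_all add: fps_diagonal_def sum.atMost_Suc_shift del: sum.atMost_Suc)
qed

lemma fps_diagonal_add: "fps_diagonal (F + G) = fps_diagonal F + fps_diagonal G"
  by (rule fps_ext) (simp add: fps_diagonal_def sum.distrib)

lemma fps_diagonal_diff: "fps_diagonal (F - G) = fps_diagonal F - fps_diagonal G"
  by (rule fps_ext) (simp add: fps_diagonal_def sum_subtractf)

lemma fps_diagonal_const [simp]: "fps_diagonal (fps_const a) = a"
  by (rule fps_ext) (simp add: fps_diagonal_def sum.atMost_shift)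

lemma fps_diagonal_fps_X [simp]: "fps_diagonal fps_X = fps_X"
  by (subst fps_diagonal_unfold) (simp add: fps_shift_fps_X fps_diagonal_const[of 1, simplified])

text \<open>
  The induction on the coefficient index peels off the first term of the outer series with
  \<open>fps_diagonal_unfold\<close>; the proof for general products follows the same pattern.
\<close>

lemma fps_diagonal_const_mult: "fps_diagonal (fps_const a * F) = a * fps_diagonal F"
proof (rule fps_ext)
  fix m show "fps_diagonal (fps_const a * F) $ m = (a * fps_diagonal F) $ m"
  proof (induction m arbitrary: F)
    case 0
    show ?case by (simp add: fps_diagonal_def)
  next
    case (Suc m)
    have sh: "fps_shift 1 (fps_const a * F) = fps_const a * fps_shift 1 F"
      by (rule fps_ext) simp
    have "fps_diagonal (fps_const a * F) $ Suc m =
        (a * F $ 0) $ Suc m + (a * fps_diagonal (fps_shift 1 F)) $ m"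
      by (subst fps_diagonal_unfold) (use Suc.IH sh in simp)
    also have "\<dots> = (a * (F $ 0 + fps_X * fps_diagonal (fps_shift 1 F))) $ Suc m"
      by (simp add: algebra_simps mult.left_commute[of a fps_X])
    finally show ?case by (subst (2) fps_diagonal_unfold)
  qed
qed

lemma fps_diagonal_mult: "fps_diagonal (F * G) = fps_diagonal F * fps_diagonal G"
proof (rule fps_ext)
  fix m show "fps_diagonal (F * G) $ m = (fps_diagonal F * fps_diagonal G) $ m"
  proof (induction m arbitrary: F)
    case 0
    show ?case by (simp add: fps_diagonal_def)
  next
    case (Suc m)
    have sh: "fps_shift 1 (F * G) = fps_const (F $ 0) * fps_shift 1 G + fps_shift 1 F * G"
    proof (rule fps_ext)
      fix n
      show "fps_shift 1 (F * G) $ n = (fps_const (F $ 0) * fps_shift 1 G + fps_shift 1 F * G) $ n"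
      proof -
        have "fps_shift 1 (F * G) $ n = (\<Sum>i=0..Suc n. F $ i * G $ (Suc n - i))"
          by (simp add: fps_mult_nth)
        also have "\<dots> = F $ 0 * G $ Suc n + (\<Sum>i=0..n. F $ Suc i * G $ (n - i))"
          by (subst sum.atLeast0_atMost_Suc_shift) simp
        finally show ?thesis by (simp add: fps_mult_nth[of "fps_shift (Suc 0) F"])
      qed
    qed
    have "fps_diagonal (F * G) $ Suc m = (F $ 0 * G $ 0) $ Suc m
        + (F $ 0 * fps_diagonal (fps_shift 1 G) + fps_diagonal (fps_shift 1 F) * fps_diagonal G) $ m"
      by (subst fps_diagonal_unfold)
        (use Suc.IH sh in \<open>simp add: fps_diagonal_add fps_diagonal_const_mult\<close>)
    also have "\<dots> = (F $ 0 * (G $ 0 + fps_X * fps_diagonal (fps_shift 1 G))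
        + fps_X * fps_diagonal (fps_shift 1 F) * fps_diagonal G) $ Suc m"
      by (simp add: algebra_simps mult.left_commute[of "F $ 0" fps_X])
    also have "\<dots> = ((F $ 0 + fps_X * fps_diagonal (fps_shift 1 F)) * fps_diagonal G) $ Suc m"
      by (subst fps_diagonal_unfold[of G, symmetric]) (simp add: algebra_simps)
    finally show ?case by (subst fps_diagonal_unfold[of F])
  qed
qed

section \<open>The functional equation\<close>

definition weight_gf :: "'a :: comm_ring_1 fps \<Rightarrow> 'a fps" where
  "weight_gf x = fps_diagonal (Abs_fps (\<lambda>n. if n = 0 then 0 else weight x n))"

text \<open>
  The coefficients are polynomials in \<open>x\<close>, so \<open>x - x'\<close> divides each of their differences, and a
  common factor passes through the sum over all coefficients.
\<close>

lemma weight_gf_dvd: "x - x' dvd weight_gf x - weight_gf x'"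
proof -
  have "x - x' dvd weight x n - weight x' n" for n
  proof -
    have "x - x' dvd x ^ d - x' ^ d" for d
      by (metis dvd_triv_left power_diff_sumr2)
    then show ?thesis
      unfolding weight_def sum_subtractf[symmetric] by (intro dvd_sum)
  qed
  then have "\<exists>q. \<forall>n. weight x n - weight x' n = (x - x') * q n"
    unfolding dvd_def by (intro choice) blast
  then obtain q where q: "\<And>n. weight x n - weight x' n = (x - x') * q n"
    by blast
  have "weight_gf x - weight_gf x' =
      fps_diagonal (fps_const (x - x') * Abs_fps (\<lambda>n. if n = 0 then 0 else q n))"
    unfolding weight_gf_def fps_diagonal_diff[symmetric]
    by (rule arg_cong[of _ _ fps_diagonal], rule fps_ext) (simp add: q)
  then show ?thesis
    by (simp add: fps_diagonal_const_mult)
qed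

text \<open>
  The constant series \<open>x\<close> in \<open>fps_const x + G\<close> is the contribution of the empty tree, with its one
  cut, as a right subtree; likewise \<open>V\<close> counts the empty tree and \<^const>\<open>I0\<close> does not.
\<close>

lemma weight_gf_eq:
  "(x - 1) * weight_gf x =
     fps_X * (x ^ 2 * (x - 1) + x * weight_gf x * (x - 1 + weight_gf x - I0))"
proof -
  define G where "G = Abs_fps (\<lambda>n. if n = 0 then 0 else weight x n)"
  define V where "V = Abs_fps (\<lambda>n. of_nat (card (av_trees n)) :: int fps)"
  have "fps_const (x - 1) * G = fps_X * (fps_const (x ^ 2 * (x - 1))
      + fps_const x * (G * (fps_const x + G - V)))"
  proof (rule fps_ext)
    fix n
    show "(fps_const (x - 1) * G) $ n = (fps_X * (fps_const (x ^ 2 * (x - 1))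
      + fps_const x * (G * (fps_const x + G - V)))) $ n"
    proof (cases n)
      case (Suc m)
      have "(G * (fps_const x + G - V)) $ m =
          (\<Sum>i = 1..m. weight x i * (weight x (m - i) - of_nat (card (av_trees (m - i)))))"
        unfolding fps_mult_nth by (subst sum.atLeast_Suc_atMost) (auto simp: G_def V_def intro!: sum.cong)
      then show ?thesis
        using weight_Suc_kernel[of x m] by (simp add: Suc G_def)
    qed (simp add: G_def)
  qed
  then have "fps_diagonal (fps_const (x - 1) * G) = fps_diagonal (fps_X * (fps_const (x ^ 2 * (x - 1))
      + fps_const x * (G * (fps_const x + G - V))))"
    by simp
  moreover have "fps_diagonal G = weight_gf x"
    by (simp add: G_def weight_gf_def)
  moreover have "fps_diagonal V = 1 + I0"
  proof (rule fps_ext)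
    fix m
    have "fps_diagonal V $ m = (\<Sum>n\<le>m. if n = m then int (card (av_trees m)) else 0)"
      unfolding fps_diagonal_def V_def
      by (auto intro!: sum.cong simp: fps_of_nat[symmetric])
    then show "fps_diagonal V $ m = (1 + I0) $ m"
      by (simp add: I0_eq_card)
  qed
  ultimately have "(x - 1) * weight_gf x =
     fps_X * (x ^ 2 * (x - 1) + x * (weight_gf x * (x + weight_gf x - (1 + I0))))"
    by (simp only: fps_diagonal_mult fps_diagonal_add fps_diagonal_diff fps_diagonal_const
        fps_diagonal_fps_X)
  then show ?thesis by (simp add: algebra_simps)
qed

section \<open>The quadratic method\<close>

text \<open>
  After clearing denominators, \<^const>\<open>R_poly\<close> depends on \<open>z\<close> and \<open>v\<close> only through the products with
  their denominators \<open>p\<close> and \<open>q\<close>, and the claim becomes a polynomial identity in \<open>y\<close>.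
\<close>

lemma R_poly_zero_of_parametrization:
  fixes y z v :: "'a :: idom"
  assumes z: "z * (1 + y + y^2) = y * (1 - y^2)^2"
    and v: "v * (1 - y^2)^2 = y * (1 - 3 * y^2 - y^3)"
    and nz: "1 + y + y^2 \<noteq> 0" "1 - y^2 \<noteq> 0"
  shows "R_poly v z = 0"
proof -
  define p q where "p = 1 + y + y^2" and "q = (1 - y^2)^2"
  have "R_poly v z * (p^4 * q^5) =
      (- (z*p) * p^3 + 3 * (z*p)^2 * p^2 + 24 * (z*p)^3 * p + (z*p)^4) * q^5
    + (p^4 - 4 * (z*p) * p^3 - 27 * (z*p)^2 * p^2 + 26 * (z*p)^3 * p + 4 * (z*p)^4) * (v*q) * q^4
    + (4 * (z*p) * p^3 - 4 * (z*p)^2 * p^2 + 29 * (z*p)^3 * p + 7 * (z*p)^4) * (v*q)^2 * q^3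
    + (6 * (z*p)^2 * p^2 + 4 * (z*p)^3 * p + 7 * (z*p)^4) * (v*q)^3 * q^2
    + 4 * ((z*p)^3 * p + (z*p)^4) * (v*q)^4 * q
    + (z*p)^4 * (v*q)^5"
    unfolding R_poly_def by algebra
  also have "\<dots> = 0"
    unfolding z[folded p_def q_def] v[folded q_def] unfolding p_def q_def by algebra
  finally show ?thesis
    using nz by (simp add: p_def q_def)
qed

text \<open>
  The elimination. The quadratic equation and \<open>S = 0\<close> give \<open>g\<^sup>2 = x (x - 1)\<close>. In terms of \<open>y = g / x\<close>
  this reads \<open>x (1 - y\<^sup>2) = 1\<close>, after which \<open>S = 0\<close> determines \<open>z v\<close>, and \<open>\<Delta>' = 0\<close> becomes linear in \<open>z\<close>.
\<close>

lemma R_poly_zero_of_double_root: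
  fixes z v x g u b b' :: "'a :: idom"
  assumes "z \<noteq> 0" and "(2 :: 'a) \<noteq> 0" and u: "x * u = 1"
    and b: "b = z * x * (x - 1) - z * x * v - (x - 1)"
    and b': "b' = z * (2 * x - 1) - z * v - 1"
    and eq: "z * x * g^2 + b * g + z * x^2 * (x - 1) = 0"
    and root: "2 * z * x * g + b = 0"
    and deriv: "2 * b * b' - 4 * z^2 * (4 * x^3 - 3 * x^2) = 0"
  shows "R_poly v z = 0"
proof -
  define y where "y = g * u"
  have g: "g = x * y" using u by (simp add: y_def mult.left_commute)
  have [simp]: "x \<noteq> 0" using u by auto
  have b2: "b = - 2 * z * x^2 * y"
    using root unfolding g by algebra
  have "z * x^2 * (x - 1 - x * y^2) = 0"
    using eq unfolding g b2 by algebra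
  then have "x - 1 - x * y^2 = 0"
    using \<open>z \<noteq> 0\<close> \<open>x \<noteq> 0\<close> unfolding mult_eq_0_iff power_eq_0_iff by blast
  then have xy: "x * (1 - y^2) = 1"
    by (simp add: algebra_simps)
  have "x * (z * v - (z * (x - 1) + 2 * z * x * y - y^2)) = 0"
    using b b2 xy by algebra
  then have zv: "z * v = z * (x - 1) + 2 * z * x * y - y^2"
    by simp
  have "2 * 2 * (z * x^2 * (y * b' + z * (4 * x - 3))) = 0"
    using deriv unfolding b2 by algebra
  then have "y * b' + z * (4 * x - 3) = 0"
    using \<open>z \<noteq> 0\<close> \<open>2 \<noteq> 0\<close> \<open>x \<noteq> 0\<close> unfolding mult_eq_0_iff power_eq_0_iff by blast
  moreover have "b' = z * x - 2 * z * x * y - (1 - y^2)"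
    unfolding b' zv by algebra
  moreover have "x * y^2 - (x - 1) = 0"
    using xy by algebra
  ultimately have "y * (z * x - 2 * z * x * y - (1 - y^2)) + z * (4 * x - 3)
      + 2 * z * (x * y^2 - (x - 1)) = 0"
    by simp
  then have "z * x * y - y * (1 - y^2) + z * (2 * x - 1) = 0"
    by algebra
  then have z: "z * (1 + y + y^2) = y * (1 - y^2)^2"
    using xy by algebra
  have "z * (v * (1 - y^2)^2 - y * (1 - 3 * y^2 - y^3)) = 0"
    using zv xy z by algebra
  then have v: "v * (1 - y^2)^2 = y * (1 - 3 * y^2 - y^3)"
    using \<open>z \<noteq> 0\<close> by simp
  have q: "1 - y^2 \<noteq> 0" using xy by auto
  have p: "1 + y + y^2 \<noteq> 0"
  proof
    assume "1 + y + y^2 = 0"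
    with z q have "y = 0" by simp
    with \<open>1 + y + y^2 = 0\<close> show False by simp
  qed
  show ?thesis
    by (rule R_poly_zero_of_parametrization[OF z v p q])
qed

text \<open>
  Brown's quadratic method for the functional equation of \<open>weight_gf\<close>. The series \<open>S x\<close> equals
  \<open>1 - x + z \<Psi>(x)\<close>, so its root is the fixed point of \<open>x \<mapsto> 1 + z \<Psi>(x)\<close>.
\<close>

lemma quadratic_method:
  fixes v :: "int fps" and G :: "int fps \<Rightarrow> int fps"
  assumes eq: "\<And>x. (x - 1) * G x = fps_X * (x^2 * (x - 1) + x * G x * (x - 1 + G x - v))"
    and cont: "\<And>x x'. x - x' dvd G x - G x'"
  shows "R_poly v fps_X = 0"
proof -
  define z where "z = (fps_X :: int fps)"
  define b where "b x = z * x * (x - 1) - z * x * v - (x - 1)" for x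
  define S where "S x = 2 * z * x * G x + b x" for x
  define \<Psi> where "\<Psi> x = x * (x - 1) - x * v + 2 * x * G x" for x
  have \<Psi>: "x - x' dvd \<Psi> x - \<Psi> x'" for x x'
  proof -
    obtain k where k: "G x = G x' + (x - x') * k"
      using cont[of x x'] by (metis add.commute diff_add_cancel dvdE)
    have "\<Psi> x - \<Psi> x' = (x - x') * (x + x' - 1 - v + 2 * x * k + 2 * G x')"
      unfolding \<Psi>_def k by algebra
    then show ?thesis by simp
  qed
  obtain x where x: "x = 1 + z * \<Psi> x"
    using fps_fixed_point[OF \<Psi>, of 1] by (auto simp: z_def)
  have S0: "S x = 0"
    using x unfolding S_def b_def \<Psi>_def by algebra
  have "x $ 0 = 1" by (subst x) (simp add: z_def)
  then obtain u where u: "x * u = 1" by (rule fps_unit_of_nth_0_eq_1)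
  have quad: "z * y * (G y)^2 + b y * G y + z * y^2 * (y - 1) = 0" for y
    using eq[of y] unfolding b_def z_def by algebra
  define b' where "b' = z * (2 * x - 1) - z * v - 1"
  define \<Delta>' where "\<Delta>' = 2 * b x * b' - 4 * z^2 * (4 * x^3 - 3 * x^2)"
  have disc: "(S y)^2 = (b y)^2 - 4 * z^2 * y^3 * (y - 1)" for y
    using quad[of y] unfolding S_def by algebra
  \<comment> \<open>In the expansion of \<open>\<Delta>(x + h)\<close> in \<open>h\<close> the constant term \<open>\<Delta>(x)\<close> vanishes and the linear
      term is \<open>h \<Delta>'\<close>. All other terms are divisible by \<open>h\<^sup>2\<close>, and so is \<open>S(x + h)\<^sup>2\<close>.\<close>
  have "h dvd \<Delta>'" if "h \<noteq> 0" for h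
  proof -
    have "x + h - x dvd \<Psi> (x + h) - \<Psi> x" by (rule \<Psi>)
    then obtain k where k: "\<Psi> (x + h) = \<Psi> x + h * k"
      by (metis add.commute add_diff_cancel_left' diff_add_cancel dvdE)
    have "S (x + h) = z * \<Psi> (x + h) - (x + h - 1)"
      unfolding S_def b_def \<Psi>_def by algebra
    then have S: "S (x + h) = h * (z * k - 1)"
      using x unfolding k by algebra
    have bh: "b (x + h) = b x + h * b' + h^2 * z"
      unfolding b_def b'_def by algebra
    have "(b x)^2 = 4 * z^2 * x^3 * (x - 1)"
      using disc[of x] S0 by simp
    then have "h * \<Delta>' = h * (h * ((z * k - 1)^2 - b'^2 - 2 * z * b x - 2 * h * z * b' - h^2 * z^2
        + 4 * z^2 * (6 * x^2 + 4 * x * h + h^2 - 3 * x - h)))"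
      using disc[of "x + h"] unfolding S bh \<Delta>'_def by algebra
    with that have "\<Delta>' = h * ((z * k - 1)^2 - b'^2 - 2 * z * b x - 2 * h * z * b' - h^2 * z^2
        + 4 * z^2 * (6 * x^2 + 4 * x * h + h^2 - 3 * x - h))" by simp
    then show ?thesis by (rule dvdI)
  qed
  then have "fps_X ^ Suc n dvd \<Delta>'" for n
    by (metis fps_X_neq_zero power_not_zero)
  then have "\<Delta>' $ n = 0" for n
    by (metis fps_X_power_dvd_iff lessI)
  then have "\<Delta>' = 0"
    by (simp add: fps_eq_iff)
  have "(2 :: int fps) $ 0 \<noteq> 0" by simp
  then have "(2 :: int fps) \<noteq> 0" by auto
  then have "R_poly v z = 0"
    using R_poly_zero_of_double_root[of z x u "b x" v b' "G x"]
      u quad[of x] S0 \<open>\<Delta>' = 0\<close> b_def[of x] b'_def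
    by (simp add: z_def \<Delta>'_def S_def)
  then show ?thesis by (simp add: z_def)
qed

section \<open>The generating function is algebraic\<close>

theorem corollary9p5:
  shows "I0 = Abs_fps (\<lambda>n. if n \<ge> 1 then int (card (W2 n \<inter> EDP)) else 0)
       \<and> R_poly I0 fps_X = 0"
proof
  show "I0 = Abs_fps (\<lambda>n. if n \<ge> 1 then int (card (W2 n \<inter> EDP)) else 0)"
    unfolding I0_eq_card
    by (rule fps_ext) (simp add: bij_betw_same_card[OF bij_betw_inorder])
  show "R_poly I0 fps_X = 0"
    by (rule quadratic_method[OF weight_gf_eq weight_gf_dvd])
qed

end
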